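(* Suppose $H(t)^*=H(t)$ for a.e. $t\in(0,d)$ and $\det J=0$. If $$H_{11},\ W_{11},\ H_{12}W_{22}^{-1}H_{21}\in M_{n_1}(L^1_{loc}(\mathbb{R})),$$ then the local index-1 hypotheses are true for $H-z_0W,\ W$ with respect to $J$ on the interval $\mathbb{R}$, for every $z_0\in\mathbb{C}\setminus\mathbb{R}$. Moreover, the same conclusion holds if $L^1_{loc}(\mathbb{R})$ is replaced by $L^1([0,d])$ in the displayed hypothesis.
   Context: Notation. For an interval $I\subseteq\mathbb{R}$, $\mathcal{M}(I)$ is the complex vector space of Lebesgue measurable functions $I\to\mathbb{C}$ (a.e. equal functions identified). $L^p_{loc}(I)$ is the set of $f\in\mathcal{M}(I)$ with $f\in L^p([\alpha,\beta])$ for every compact interval $[\alpha,\beta]\subseteq I$. $M_{m\times k}(\mathcal{V})$ denotes $m\times k$ matrices with entries in $\mathcal{V}$, $M_n(\mathcal{V})=M_{n\times n}(\mathcal{V})$; $A^*$ is the (pointwise) conjugate transpose. Standing data. $n\in\mathbb{N}$, $d\in(0,\infty)$; $J\in M_n(\mathbb{C})$ with $J\neq0$, $J^*=-J$; $H,W:\mathbb{R}\to M_n(\mathbb{C})$ have Lebesgue measurable entries and are $d$-periodic: $H(t+d)=H(t)$, $W(t+d)=W(t)$ for all $t$; and $W(t)^*=W(t)\ge0$, $\det W(t)\neq0$ for a.e. $t\in\mathbb{R}$. Block structure when $\det J=0$. Put $n_1=\operatorname{rank}J$, $n_2=\dim\ker J=n-n_1$, and fix a unitary $V\in M_n(\mathbb{C})$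 with $V^{-1}JV=\begin{bmatrix}J_{11}&0\\0&0\end{bmatrix}$, $J_{11}\in M_{n_1}(\mathbb{C})$, $\det J_{11}\neq0$ (first $n_1$ columns an orthonormal basis of $\operatorname{ran}J$, the rest of $\ker J$). For a matrix function $A$ write $V^{-1}AV=[A_{ij}]_{i,j=1,2}$ with $A_{ij}$ of size $n_i\times n_j$; in particular this defines $H_{ij}$ and $W_{ij}$. If $A_{22}$ is invertible a.e., the Schur complement is $A/A_{22}=A_{11}-A_{12}A_{22}^{-1}A_{21}$. Local index-1 hypotheses (case $\det J=0$). For a measurable $A:I\to M_n(\mathbb{C})$, the local index-1 hypotheses for $A,W$ with respect to $J$ on $I$ are: $A_{22}^{-1}\in M_{n_2}(\mathcal{M}(I))$ (i.e., $A_{22}(t)$ is invertible for a.e. $t$), $A_{12}A_{22}^{-1}W_{22}^{1/2}\in M_{n_1\times n_2}(L^2_{loc}(I))$, $A/A_{22},\,W_{11}\in M_{n_1}(L^1_{loc}(I))$, $W_{22}^{1/2}A_{22}^{-1}W_{22}^{1/2}\in M_{n_2}(L^\infty_{loc}(I))$, $W_{22}^{1/2}(W_{22}^{-1}W_{21}-A_{22}^{-1}A_{21})\in M_{n_2\times n_1}(L^2_{loc}(I))$, and $W/W_{22}\in M_{n_1}(L^1_{loc}(I))$. In the claim, $I=\mathbb{R}$ and $A=H-z_0W$. ($W_{22}^{1/2}$ is the pointwise positive square root.) *)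

theory Defs
  imports "HOL-Analysis.Analysis"
begin

section \<open>Function spaces\<close>

text \<open>Functions that agree almost everywhere are not identified: elements of the spaces below are
  representatives. All conditions are invariant under changes on null sets, so the values that
  total operations such as \<^const>\<open>matrix_inv\<close> take where they are mathematically undefined
  do not matter as long as this happens on a null set only.\<close>

definition meas_on :: "real set \<Rightarrow> (real \<Rightarrow> complex) set" where
  "meas_on I = borel_measurable (lebesgue_on I)"

text \<open>The exponent ranges over \<open>1 \<le> p \<le> \<infinity>\<close>.\<close>

definition Lp :: "ennreal \<Rightarrow> real set \<Rightarrow> (real \<Rightarrow> complex) set" where
  "Lp p I = {f \<in> meas_on I.
     if p = \<infinity> then \<exists>C. AE t in lebesgue_on I. norm (f t) \<le> C
     else integrable (lebesgue_on I) (\<lambda>t. norm (f t) powr enn2real p)}"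

definition Lp_loc :: "ennreal \<Rightarrow> real set \<Rightarrow> (real \<Rightarrow> complex) set" where
  "Lp_loc p I = {f \<in> meas_on I. \<forall>a b. a \<le> b \<and> {a..b} \<subseteq> I \<longrightarrow> f \<in> Lp p {a..b}}"

definition matrices_over ::
    "(real \<Rightarrow> complex) set \<Rightarrow> (real \<Rightarrow> complex^'k^'m) set" where
  "matrices_over \<V> = {A. \<forall>i j. (\<lambda>t. A t $ i $ j) \<in> \<V>}"

section \<open>Complex matrices\<close>

definition conj_transpose :: "complex^'k^'m \<Rightarrow> complex^'m^'k" where
  "conj_transpose A = map_matrix cnj (transpose A)"

definition unitary_matrix :: "complex^'k^'m \<Rightarrow> bool" where
  "unitary_matrix V \<longleftrightarrow> conj_transpose V ** V = mat 1 \<and> V ** conj_transpose V = mat 1"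

text \<open>The quadratic form of a Hermitian matrix is real-valued, so that taking the real part
  loses nothing.\<close>

definition psd :: "complex^'k^'k \<Rightarrow> bool" where
  "psd A \<longleftrightarrow> conj_transpose A = A \<and> (\<forall>x. 0 \<le> Re (\<Sum>i\<in>UNIV. cnj (x $ i) * (A *v x) $ i))"

definition psd_sqrt :: "complex^'k^'k \<Rightarrow> complex^'k^'k" where
  "psd_sqrt A = (THE B. psd B \<and> B ** B = A)"

section \<open>Blocks with respect to the kernel of \<open>J\<close>\<close>

text \<open>The first \<open>n\<^sub>1\<close> and the last \<open>n\<^sub>2\<close> of the \<open>n\<close> columns of the unitary matrix \<open>V\<close> are
  indexed by \<^typ>\<open>'p\<close> and \<^typ>\<open>'q\<close>, i.e. the columns are indexed by the sum type
  \<^typ>\<open>'p + 'q\<close>. Index types are nonempty, which is no restriction here: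
  \<open>0 < n\<^sub>1 < n\<close> because \<open>J \<noteq> 0\<close> and \<open>det J = 0\<close>.\<close>

definition block11 :: "complex^('p::finite + 'q::finite)^'n \<Rightarrow> complex^'n^'n \<Rightarrow> complex^'p^'p" where
  "block11 V A = (\<chi> i j. (matrix_inv V ** A ** V) $ Inl i $ Inl j)"

definition block12 :: "complex^('p::finite + 'q::finite)^'n \<Rightarrow> complex^'n^'n \<Rightarrow> complex^'q^'p" where
  "block12 V A = (\<chi> i j. (matrix_inv V ** A ** V) $ Inl i $ Inr j)"

definition block21 :: "complex^('p::finite + 'q::finite)^'n \<Rightarrow> complex^'n^'n \<Rightarrow> complex^'p^'q" where
  "block21 V A = (\<chi> i j. (matrix_inv V ** A ** V) $ Inr i $ Inl j)"

definition block22 :: "complex^('p::finite + 'q::finite)^'n \<Rightarrow> complex^'n^'n \<Rightarrow> complex^'q^'q" where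
  "block22 V A = (\<chi> i j. (matrix_inv V ** A ** V) $ Inr i $ Inr j)"

definition schur_complement :: "complex^('p::finite + 'q::finite)^'n \<Rightarrow> complex^'n^'n \<Rightarrow> complex^'p^'p" where
  "schur_complement V A = block11 V A - block12 V A ** matrix_inv (block22 V A) ** block21 V A"

text \<open>The block form forces the first columns of \<open>V\<close> to be an orthonormal basis of the range of
  \<open>J\<close> and the others to be one of its kernel.\<close>

definition kernel_splitting :: "complex^'n^'n \<Rightarrow> complex^('p::finite + 'q::finite)^'n \<Rightarrow> bool" where
  "kernel_splitting J V \<longleftrightarrow> unitary_matrix V \<and>
     block12 V J = 0 \<and> block21 V J = 0 \<and> block22 V J = 0 \<and> det (block11 V J) \<noteq> 0"

text \<open>The dependence on \<open>J\<close> is through the splitting matrix \<open>V\<close>.\<close>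

definition local_index_1 ::
    "complex^('p::finite + 'q::finite)^'n \<Rightarrow> (real \<Rightarrow> complex^'n^'n) \<Rightarrow> (real \<Rightarrow> complex^'n^'n) \<Rightarrow> real set \<Rightarrow> bool"
  where
  "local_index_1 V A W I \<longleftrightarrow>
     (AE t in lebesgue_on I. invertible (block22 V (A t))) \<and>
     (\<lambda>t. matrix_inv (block22 V (A t))) \<in> matrices_over (meas_on I) \<and>
     (\<lambda>t. block12 V (A t) ** matrix_inv (block22 V (A t)) ** psd_sqrt (block22 V (W t)))
       \<in> matrices_over (Lp_loc 2 I) \<and>
     (\<lambda>t. schur_complement V (A t)) \<in> matrices_over (Lp_loc 1 I) \<and>
     (\<lambda>t. block11 V (W t)) \<in> matrices_over (Lp_loc 1 I) \<and>
     (\<lambda>t. psd_sqrt (block22 V (W t)) ** matrix_inv (block22 V (A t)) ** psd_sqrt (block22 V (W t)))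
       \<in> matrices_over (Lp_loc \<infinity> I) \<and>
     (\<lambda>t. psd_sqrt (block22 V (W t)) **
          (matrix_inv (block22 V (W t)) ** block21 V (W t) -
           matrix_inv (block22 V (A t)) ** block21 V (A t)))
       \<in> matrices_over (Lp_loc 2 I) \<and>
     (\<lambda>t. schur_complement V (W t)) \<in> matrices_over (Lp_loc 1 I)"

end

theory Submission
  imports Defs
begin

text \<open>Put \<open>A = H - z W\<close>, \<open>S = W\<^sub>2\<^sub>2\<^sup>1\<^sup>/\<^sup>2\<close>, \<open>T = H\<^sub>1\<^sub>2 S\<^sup>-\<^sup>1\<close>, \<open>U = W\<^sub>1\<^sub>2 S\<^sup>-\<^sup>1\<close>, \<open>B = T - z U\<close>,
  \<open>B' = T\<^sup>* - z U\<^sup>*\<close> and \<open>R = S A\<^sub>2\<^sub>2\<^sup>-\<^sup>1 S = (S\<^sup>-\<^sup>1 H\<^sub>2\<^sub>2 S\<^sup>-\<^sup>1 - z)\<^sup>-\<^sup>1\<close>, the resolvent of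
  a Hermitian matrix, which is bounded by \<open>1 / |Im z|\<close>. The entries of \<open>T\<close> are square integrable because
  \<open>T T\<^sup>* = H\<^sub>1\<^sub>2 W\<^sub>2\<^sub>2\<^sup>-\<^sup>1 H\<^sub>2\<^sub>1\<close> is integrable, those of \<open>U\<close> because
  \<open>U U\<^sup>* = W\<^sub>1\<^sub>2 W\<^sub>2\<^sub>2\<^sup>-\<^sup>1 W\<^sub>2\<^sub>1 \<le> W\<^sub>1\<^sub>1\<close>. All the matrix functions in question are then expressed
  through bounded and square integrable factors: \<open>A\<^sub>1\<^sub>2 A\<^sub>2\<^sub>2\<^sup>-\<^sup>1 S = B R\<close>,
  \<open>A/A\<^sub>2\<^sub>2 = H\<^sub>1\<^sub>1 - z W\<^sub>1\<^sub>1 - B R B'\<close>, \<open>S (W\<^sub>2\<^sub>2\<^sup>-\<^sup>1 W\<^sub>2\<^sub>1 - A\<^sub>2\<^sub>2\<^sup>-\<^sup>1 A\<^sub>2\<^sub>1) = U\<^sup>* - R B'\<close> and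
  \<open>W/W\<^sub>2\<^sub>2 = W\<^sub>1\<^sub>1 - U U\<^sup>*\<close>.\<close>

section \<open>Positive matrices\<close>

lemma conj_transpose_nth [simp]: "conj_transpose A $ i $ j = cnj (A $ j $ i)"
  by (simp add: conj_transpose_def transpose_def)

lemma conj_transpose_conj_transpose [simp]: "conj_transpose (conj_transpose A) = A"
  by (simp add: vec_eq_iff)

lemma conj_transpose_mult:
  "conj_transpose (A ** B) = conj_transpose B ** conj_transpose A"
  by (simp add: vec_eq_iff matrix_matrix_mult_def mult.commute)

lemma conj_transpose_add: "conj_transpose (A + B) = conj_transpose A + conj_transpose B"
  by (simp add: vec_eq_iff)

lemma conj_transpose_diff: "conj_transpose (A - B) = conj_transpose A - conj_transpose B"
  by (simp add: vec_eq_iff)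

lemma conj_transpose_scaleR: "conj_transpose (r *\<^sub>R A) = r *\<^sub>R conj_transpose A"
  by (simp add: vec_eq_iff)

lemma conj_transpose_mat_1 [simp]: "conj_transpose (mat 1) = mat 1"
  by (simp add: vec_eq_iff mat_def)

lemma conj_transpose_0 [simp]: "conj_transpose 0 = 0"
  by (simp add: vec_eq_iff)

text \<open>The library's inner product on complex vectors is real: it is the real part of the
  Hermitian product. It is symmetric, and paired with \<open>A *v x\<close> it gives exactly the
  quantity tested in \<open>psd\<close>.\<close>

lemma inner_cvec: "x \<bullet> y = Re (\<Sum>i\<in>UNIV. cnj (x $ i) * y $ i)"
  for x y :: "complex^'n"
  by (simp add: inner_vec_def inner_complex_def)

lemma inner_matrix_vector_mult:
  fixes A :: "complex^'n^'m"
  shows "x \<bullet> (A *v y) = (conj_transpose A *v x) \<bullet> y"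
proof -
  have "(\<Sum>i\<in>UNIV. cnj (x $ i) * (A *v y) $ i) = (\<Sum>i\<in>UNIV. \<Sum>j\<in>UNIV. cnj (x $ i) * A $ i $ j * y $ j)"
    by (simp add: matrix_vector_mult_def sum_distrib_left mult.assoc)
  also have "\<dots> = (\<Sum>j\<in>UNIV. \<Sum>i\<in>UNIV. cnj (x $ i) * A $ i $ j * y $ j)"
    by (rule sum.swap)
  also have "\<dots> = (\<Sum>j\<in>UNIV. cnj ((conj_transpose A *v x) $ j) * y $ j)"
    by (simp add: matrix_vector_mult_def sum_distrib_left mult_ac)
  finally show ?thesis
    by (simp add: inner_cvec)
qed

lemma scaleR_matrix_vector_mult: "(r *\<^sub>R A) *v x = r *\<^sub>R (A *v x)"
  for A :: "complex^'n^'m"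
  by (simp add: vec_eq_iff matrix_vector_mult_def scaleR_sum_right)

lemma matrix_vector_mult_scaleR_right: "A *v (r *\<^sub>R x) = r *\<^sub>R (A *v x)"
  for A :: "complex^'n^'m"
  by (simp add: vec_eq_iff matrix_vector_mult_def scaleR_sum_right)

lemma matrix_diff_ldistrib: "A ** (B - C) = A ** B - A ** C"
  for A :: "complex^'n^'m"
  by (simp add: vec_eq_iff matrix_matrix_mult_def left_diff_distrib right_diff_distrib sum_subtractf)

lemma matrix_diff_rdistrib: "(B - C) ** A = B ** A - C ** A"
  for A :: "complex^'n^'m"
  by (simp add: vec_eq_iff matrix_matrix_mult_def left_diff_distrib right_diff_distrib sum_subtractf)

lemma matrix_vector_mult_axis: "(A *v axis j 1) $ i = A $ i $ j"
  for A :: "complex^'n^'m"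
  by (simp add: matrix_vector_mult_def axis_def if_distrib cong: if_cong)

text \<open>An entry is a coordinate of the image of a unit vector. This turns operator norm
  estimates into the entrywise ones that \<open>matrices_over\<close> asks for.\<close>

lemma norm_nth_le_of_bound:
  fixes A :: "complex^'n^'m"
  assumes "\<And>x. norm (A *v x) \<le> K * norm x"
  shows "norm (A $ i $ j) \<le> K"
proof -
  have "norm (A $ i $ j) \<le> norm (A *v axis j 1)"
    by (metis matrix_vector_mult_axis Finite_Cartesian_Product.norm_nth_le)
  also have "\<dots> \<le> K"
    using assms[of "axis j 1"] by simp
  finally show ?thesis .
qed

section \<open>Positive semidefinite and positive definite matrices\<close>

lemma psd_iff_inner: "psd A \<longleftrightarrow> conj_transpose A = A \<and> (\<forall>x. 0 \<le> x \<bullet> (A *v x))"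
  by (simp add: psd_def inner_cvec)

definition posdef :: "complex^'k^'k \<Rightarrow> bool" where
  "posdef A \<longleftrightarrow> conj_transpose A = A \<and> (\<forall>x. x \<noteq> 0 \<longrightarrow> 0 < x \<bullet> (A *v x))"

lemma posdef_imp_psd: "posdef A \<Longrightarrow> psd A"
  unfolding posdef_def psd_iff_inner by (metis inner_zero_left order.order_iff_strict)

lemma invertible_if_kernel_trivial:
  fixes A :: "complex^'k^'k"
  assumes "\<And>x. A *v x = 0 \<Longrightarrow> x = 0"
  shows "invertible A"
  using assms by (simp add: invertible_left_inverse matrix_left_invertible_ker)

lemma posdef_invertible: "posdef A \<Longrightarrow> invertible A"
  by (rule invertible_if_kernel_trivial) (metis posdef_def inner_zero_right less_irrefl)

text \<open>Variational argument: moving from \<open>x\<close> in the direction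
  \<open>A *v x\<close> changes the form to first order by twice the squared norm of
  \<open>A *v x\<close>, so a small step backwards would make it negative.\<close>

lemma psd_form_eq_0:
  assumes "psd A" "x \<bullet> (A *v x) = 0"
  shows "A *v x = 0"
proof (rule ccontr)
  let ?y = "A *v x"
  define a b where "a = ?y \<bullet> ?y" and "b = ?y \<bullet> (A *v ?y)"
  assume "?y \<noteq> 0"
  then have a: "a > 0" by (simp add: a_def)
  have herm: "conj_transpose A = A" and nn: "\<And>x. 0 \<le> x \<bullet> (A *v x)"
    using assms(1) by (auto simp: psd_iff_inner)
  have b: "b \<ge> 0" using nn by (simp add: b_def)
  have exp: "(x + s *\<^sub>R ?y) \<bullet> (A *v (x + s *\<^sub>R ?y)) = 2 * s * a + s^2 * b" for s
    using assms(2) inner_matrix_vector_mult[of x A ?y]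
    by (simp add: herm a_def b_def matrix_vector_mult_scaleR_right algebra_simps power2_eq_square inner_commute
        inner_add_left inner_add_right)
  \<comment> \<open>The minimiser would be - a / b; the added 1 covers b = 0 and still leaves a
    negative value.\<close>
  define s where "s = - a / (b + 1)"
  have "b + 1 \<noteq> 0" using b by simp
  then have "2 * s * a + s^2 * b = - (a^2 * (b + 2)) / (b + 1)^2"
    unfolding s_def by (simp add: divide_simps power2_eq_square) (simp add: algebra_simps)
  also have "\<dots> < 0"
    using a b by (simp add: divide_neg_pos)
  finally show False
    using nn[of "x + s *\<^sub>R ?y"] by (simp add: exp)
qed

lemma posdef_if_psd_det:
  assumes "psd A" "det A \<noteq> 0"
  shows "posdef A"
  unfolding posdef_def
proof (intro conjI allI impI)
  show "conj_transpose A = A" using assms by (simp add: psd_iff_inner)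
  fix x :: "complex^'a" assume "x \<noteq> 0"
  moreover have "A *v x \<noteq> 0"
    using \<open>x \<noteq> 0\<close> assms(2) invertible_det_nz invertible_left_inverse matrix_left_invertible_ker
    by blast
  ultimately show "0 < x \<bullet> (A *v x)"
    using assms(1) psd_form_eq_0[of A x] unfolding psd_iff_inner by (metis order.order_iff_strict)
qed

text \<open>The form attains its minimum on the compact unit sphere, where it is positive;
  homogeneity of degree two extends the bound to all vectors.\<close>

lemma posdef_coercive:
  fixes A :: "complex^'k^'k"
  assumes "posdef A"
  obtains m where "m > 0" "\<And>x. m * (norm x)^2 \<le> x \<bullet> (A *v x)"
proof -
  have "continuous_on (sphere 0 1) (\<lambda>x. x \<bullet> (A *v x))"
    by (intro continuous_intros linear_continuous_on matrix_vector_mul_bounded_linear)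
  moreover have "compact (sphere (0::complex^'k) 1)" "sphere (0::complex^'k) 1 \<noteq> {}"
    by auto
  ultimately obtain u where u: "norm u = 1" and min: "\<And>x. norm x = 1 \<Longrightarrow> u \<bullet> (A *v u) \<le> x \<bullet> (A *v x)"
    using continuous_attains_inf[of "sphere 0 1" "\<lambda>x. x \<bullet> (A *v x)"] by force
  show thesis
  proof (rule that)
    show "0 < u \<bullet> (A *v u)"
      using assms u unfolding posdef_def by (metis norm_zero zero_neq_one)
    fix x :: "complex^'k"
    show "u \<bullet> (A *v u) * (norm x)^2 \<le> x \<bullet> (A *v x)"
    proof (cases "x = 0")
      case False
      define y where "y = x /\<^sub>R norm x"
      have x: "x = norm x *\<^sub>R y" using False by (simp add: y_def)
      have "x \<bullet> (A *v x) = (norm x *\<^sub>R y) \<bullet> (A *v (norm x *\<^sub>R y))"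
        using x by simp
      also have "\<dots> = (norm x)^2 * (y \<bullet> (A *v y))"
        by (simp add: matrix_vector_mult_scaleR_right power2_eq_square)
      finally have "x \<bullet> (A *v x) = (norm x)^2 * (y \<bullet> (A *v y))" .
      then show ?thesis
        using min[of y] False by (simp add: y_def mult.commute mult_left_mono)
    qed simp
  qed
qed

section \<open>The positive square root\<close>

text \<open>If \<open>A\<close> is a strict contraction, so is the map \<open>Y \<mapsto> (A + Y\<^sup>2) / 2\<close> on the matrices bounded by
  the same constant, and its fixed point satisfies \<open>(1 - Y)\<^sup>2 = 1 - A\<close>.\<close>

primrec sqrt_iter :: "complex^'k^'k \<Rightarrow> nat \<Rightarrow> complex^'k^'k" where
  "sqrt_iter A 0 = 0"
| "sqrt_iter A (Suc k) = (1/2) *\<^sub>R (A + sqrt_iter A k ** sqrt_iter A k)"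

text \<open>The ball of operator radius r is invariant under the iteration because (r + r^2) / 2 <=
  r for r between 0 and 1.\<close>

lemma sqrt_iter_bound:
  assumes r: "0 \<le> r" "r \<le> 1" and A: "\<And>x. norm (A *v x) \<le> r * norm x"
  shows "norm (sqrt_iter A k *v x) \<le> r * norm x"
proof (induction k arbitrary: x)
  case 0
  then show ?case using r by simp
next
  case (Suc k)
  let ?Y = "sqrt_iter A k"
  have "norm (?Y *v (?Y *v x)) \<le> r * (r * norm x)"
    using Suc[of "?Y *v x"] Suc[of x] r by (meson mult_left_mono order_trans)
  also have "\<dots> \<le> 1 * (r * norm x)"
    by (intro mult_right_mono) (use r in auto)
  finally have "norm (A *v x + ?Y *v (?Y *v x)) \<le> 2 * (r * norm x)"
    using A[of x] norm_triangle_ineq[of "A *v x" "?Y *v (?Y *v x)"] by linarith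
  then show ?case
    by (simp add: scaleR_matrix_vector_mult matrix_vector_mult_add_rdistrib matrix_vector_mul_assoc)
qed

text \<open>For consecutive iterates Y, Z and D = Z - Y, the identity Z^2 - Y^2 = Z D + D Y holds
  without commutativity. The outer factors Z and Y are bounded by r, so the halved sum gains one
  factor r.\<close>

lemma sqrt_iter_step_bound:
  assumes r: "0 \<le> r" "r \<le> 1" and A: "\<And>x. norm (A *v x) \<le> r * norm x"
  shows "norm ((sqrt_iter A (Suc k) - sqrt_iter A k) *v x) \<le> r ^ Suc k * norm x"
proof (induction k arbitrary: x)
  case 0
  have "norm (A *v x) / 2 \<le> norm (A *v x)" by simp
  also have "\<dots> \<le> r * norm x" by (rule A)
  finally show ?case
    by (simp add: scaleR_matrix_vector_mult)
next
  case (Suc k)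
  let ?Y = "sqrt_iter A k" and ?Z = "sqrt_iter A (Suc k)"
  let ?D = "?Z - ?Y"
  have split: "sqrt_iter A (Suc (Suc k)) - ?Z = (1/2) *\<^sub>R (?Z ** ?D + ?D ** ?Y)"
    by (simp add: sqrt_iter.simps(2)[of A "Suc k"] matrix_diff_ldistrib matrix_diff_rdistrib
        algebra_simps del: sqrt_iter.simps(2)) (simp add: algebra_simps)
  have "norm (?Z *v (?D *v x)) \<le> r * (r ^ Suc k * norm x)"
    using sqrt_iter_bound[OF r A, of "Suc k" "?D *v x"] Suc[of x] r by (meson mult_left_mono order_trans)
  moreover have "norm (?D *v (?Y *v x)) \<le> r ^ Suc k * (r * norm x)"
    using sqrt_iter_bound[OF r A, of k x] Suc[of "?Y *v x"] r
    by (meson mult_left_mono order_trans zero_le_power)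
  ultimately have "norm (?Z *v (?D *v x) + ?D *v (?Y *v x)) \<le> 2 * (r ^ Suc (Suc k) * norm x)"
    using norm_triangle_ineq[of "?Z *v (?D *v x)" "?D *v (?Y *v x)"] by (simp add: mult_ac)
  then show ?case
    unfolding split
    by (simp add: scaleR_matrix_vector_mult matrix_vector_mult_add_rdistrib matrix_vector_mul_assoc
        del: sqrt_iter.simps)
qed

lemma tendsto_matrix_mult:
  fixes A :: "'a \<Rightarrow> complex^'n^'m"
  assumes "(A \<longlongrightarrow> A') F" "(B \<longlongrightarrow> B') F"
  shows "((\<lambda>t. A t ** B t) \<longlongrightarrow> A' ** B') F"
  unfolding matrix_matrix_mult_def
  by (intro vec_tendstoI) (auto intro!: tendsto_intros assms)

text \<open>Entrywise the increments are dominated by a geometric series, hence the telescoping sums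
  converge. Symmetry, the recursion and the norm bound pass to the limit.\<close>

lemma sqrt_iter_limit:
  fixes A :: "complex^'k^'k"
  assumes r: "0 \<le> r" "r < 1" and A: "\<And>x. norm (A *v x) \<le> r * norm x"
    and herm: "conj_transpose A = A"
  obtains Y where "sqrt_iter A \<longlonglongrightarrow> Y" "conj_transpose Y = Y" "Y + Y = A + Y ** Y"
    "\<And>x. norm (Y *v x) \<le> r * norm x"
proof -
  have "\<exists>l. (\<lambda>k. sqrt_iter A k $ i $ j) \<longlonglongrightarrow> l" for i j
  proof -
    define D where "D k = sqrt_iter A (Suc k) $ i $ j - sqrt_iter A k $ i $ j" for k
    have "norm (D k) \<le> r ^ Suc k" for k
      using norm_nth_le_of_bound[OF sqrt_iter_step_bound[OF r(1) less_imp_le[OF r(2)] A], of k i j]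
      by (simp add: D_def)
    moreover have "summable (\<lambda>k. r ^ Suc k)"
      using r by (simp add: summable_geometric)
    ultimately have "summable D"
      by (meson summable_comparison_test')
    then have "(\<lambda>n. \<Sum>k<n. D k) \<longlonglongrightarrow> suminf D"
      by (rule summable_LIMSEQ)
    moreover have "(\<Sum>k<n. D k) = sqrt_iter A n $ i $ j" for n
      unfolding D_def by (subst sum_lessThan_telescope) simp
    ultimately show ?thesis by auto
  qed
  then obtain L where L: "\<And>i j. (\<lambda>k. sqrt_iter A k $ i $ j) \<longlonglongrightarrow> L i j"
    by metis
  define Y :: "complex^'k^'k" where "Y = (\<chi> i j. L i j)"
  have Y: "sqrt_iter A \<longlonglongrightarrow> Y"
    by (intro vec_tendstoI) (simp add: Y_def L)
  have itherm: "conj_transpose (sqrt_iter A k) = sqrt_iter A k" for k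
    by (induction k) (simp_all add: herm conj_transpose_add conj_transpose_scaleR conj_transpose_mult
)
  show thesis
  proof (rule that[OF Y])
    show "conj_transpose Y = Y"
    proof -
      have "(\<lambda>k. conj_transpose (sqrt_iter A k)) \<longlonglongrightarrow> conj_transpose Y"
        by (intro vec_tendstoI) (auto intro!: tendsto_intros Y)
      then show ?thesis
        using Y by (simp add: itherm LIMSEQ_unique)
    qed
    have "(\<lambda>k. sqrt_iter A (Suc k)) \<longlonglongrightarrow> (1/2) *\<^sub>R (A + Y ** Y)"
      unfolding sqrt_iter.simps by (intro tendsto_intros tendsto_matrix_mult Y)
    then have "Y = (1/2) *\<^sub>R (A + Y ** Y)"
      using LIMSEQ_Suc[OF Y] LIMSEQ_unique by blast
    then have "2 *\<^sub>R Y = 2 *\<^sub>R ((1/2) *\<^sub>R (A + Y ** Y))"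
      by (rule arg_cong)
    then show "Y + Y = A + Y ** Y"
      by (simp only: scaleR_scaleR) (simp add: scaleR_2)
    fix x
    have "(\<lambda>k. sqrt_iter A k *v x) \<longlonglongrightarrow> Y *v x"
      unfolding matrix_vector_mult_def by (intro vec_tendstoI) (auto intro!: tendsto_intros Y)
    then show "norm (Y *v x) \<le> r * norm x"
      using sqrt_iter_bound[OF r(1) less_imp_le[OF r(2)] A]
      by (intro tendsto_upperbound[OF tendsto_norm]) auto
  qed
qed

text \<open>With \<open>D = B - C\<close> one has \<open>B D + D C = 0\<close>; multiplying by \<open>D\<close> and taking traces yields
  \<open>tr (D B D) + tr (D C D) = 0\<close>, where both summands are nonnegative.\<close>

lemma psd_square_root_unique:
  fixes B C :: "complex^'k^'k"
  assumes B: "psd B" and C: "posdef C" and eq: "B ** B = C ** C"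
  shows "B = C"
proof -
  define D where "D = B - C"
  have hB: "conj_transpose B = B" and hC: "conj_transpose C = C"
    using B C by (auto simp: psd_iff_inner posdef_def)
  then have hD: "conj_transpose D = D"
    by (simp add: D_def conj_transpose_diff)
  \<comment> \<open>As D is Hermitian, each diagonal entry of D M D is the form of M at a column of
    D.\<close>
  have form: "Re (trace (D ** M ** D)) = (\<Sum>i\<in>UNIV. (D *v axis i 1) \<bullet> (M *v (D *v axis i 1)))" for M
  proof -
    have "(D *v axis i 1) \<bullet> (M *v (D *v axis i 1)) = axis i 1 \<bullet> ((D ** M ** D) *v axis i 1)" for i
      using inner_matrix_vector_mult[of "axis i 1" D "M *v (D *v axis i 1)"]
      by (simp add: hD matrix_vector_mul_assoc matrix_mul_assoc)
    also have "\<dots> i = Re ((D ** M ** D) $ i $ i)" for i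
      by (simp add: inner_axis' matrix_vector_mult_axis inner_complex_def)
    finally show ?thesis
      by (simp add: trace_def)
  qed
  have "B ** D + D ** C = 0"
    by (simp add: D_def matrix_diff_ldistrib matrix_diff_rdistrib eq)
  then have "D ** B ** D + D ** D ** C = 0"
    by (metis matrix_add_ldistrib matrix_mul_assoc times0_right)
  then have "trace (D ** B ** D + D ** D ** C) = 0"
    by (simp add: trace_def)
  then have "trace (D ** B ** D) + trace (D ** D ** C) = 0"
    by (simp only: trace_add)
  moreover have "trace (D ** D ** C) = trace (D ** C ** D)"
    by (metis matrix_mul_assoc trace_mul_sym)
  ultimately have sum0: "(\<Sum>i\<in>UNIV. (D *v axis i 1) \<bullet> (B *v (D *v axis i 1))) +
      (\<Sum>i\<in>UNIV. (D *v axis i 1) \<bullet> (C *v (D *v axis i 1))) = 0"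
    unfolding form[symmetric] by (metis plus_complex.sel(1) zero_complex.sel(1))
  have nnB: "0 \<le> x \<bullet> (B *v x)" and nnC: "0 \<le> x \<bullet> (C *v x)" for x
    using B posdef_imp_psd[OF C] by (auto simp: psd_iff_inner)
  \<comment> \<open>Two nonnegative numbers with sum zero both vanish. The one belonging to C is
    enough: strict positivity of C then kills every column of D.\<close>
  have "(\<Sum>i\<in>UNIV. (D *v axis i 1) \<bullet> (C *v (D *v axis i 1))) = 0"
    using sum0 sum_nonneg[of UNIV "\<lambda>i. (D *v axis i 1) \<bullet> (B *v (D *v axis i 1))"]
      sum_nonneg[of UNIV "\<lambda>i. (D *v axis i 1) \<bullet> (C *v (D *v axis i 1))"] nnB nnC
    by (simp add: add_nonneg_eq_0_iff)
  then have "(D *v axis i 1) \<bullet> (C *v (D *v axis i 1)) = 0" for i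
    by (subst (asm) sum_nonneg_eq_0_iff) (auto simp: nnC)
  then have "D *v axis i 1 = 0" for i
    using C unfolding posdef_def by (metis less_irrefl)
  then have "D = 0"
    by (metis matrix_vector_mult_axis vec_eq_iff zero_index)
  then show ?thesis by (simp add: D_def)
qed

lemma psd_sqrt_eqI:
  assumes "posdef C" "C ** C = P"
  shows "psd_sqrt P = C"
  unfolding psd_sqrt_def
proof (rule the_equality)
  show "psd C \<and> C ** C = P"
    using assms by (simp add: posdef_imp_psd)
  show "B = C" if "psd B \<and> B ** B = P" for B
    by (rule psd_square_root_unique) (use that assms in auto)
qed

text \<open>For large c the matrix A = 1 - P / c is a strict contraction, so the iteration yields Y
  with (1 - Y)^2 = P / c, and sqrt c times 1 - Y is the root. The limit formula is kept for all
  large c because measurability will be read off from it; the description defining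
  \<open>psd_sqrt\<close> gives none.\<close>

lemma
  fixes P :: "complex^'k^'k"
  assumes P: "posdef P"
  shows posdef_psd_sqrt: "posdef (psd_sqrt P)"
    and psd_sqrt_square: "psd_sqrt P ** psd_sqrt P = P"
    and psd_sqrt_limit: "\<exists>c\<^sub>0. \<forall>c\<ge>c\<^sub>0.
      (\<lambda>k. sqrt c *\<^sub>R (mat 1 - sqrt_iter (mat 1 - (1/c) *\<^sub>R P) k)) \<longlonglongrightarrow> psd_sqrt P"
proof -
  obtain m where m: "m > 0" "\<And>x. m * (norm x)^2 \<le> x \<bullet> (P *v x)"
    using posdef_coercive[OF P] by blast
  obtain K where K: "K > 0" "\<And>x. norm (P *v x) \<le> norm x * K"
    using bounded_linear.pos_bounded[OF matrix_vector_mul_bounded_linear[of P]] by blast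
  \<comment> \<open>The first summand gives K^2 <= m c, which controls the quadratic term of the
    norm of A x; the second gives m <= c, so that the square root defining r is real.\<close>
  define c\<^sub>0 where "c\<^sub>0 = K^2 / m + m"
  have main: "(\<lambda>k. sqrt c *\<^sub>R (mat 1 - sqrt_iter (mat 1 - (1/c) *\<^sub>R P) k)) \<longlonglongrightarrow> psd_sqrt P \<and>
      posdef (psd_sqrt P) \<and> psd_sqrt P ** psd_sqrt P = P" if c: "c \<ge> c\<^sub>0" for c
  proof -
    define A where "A = mat 1 - (1/c) *\<^sub>R P"
    \<comment> \<open>The squared norm of A x is at most 1 - 2 m / c + m / c times that of x: the
      middle term comes from coercivity, the last one from K^2 <= m c.\<close>
    define r where "r = sqrt (1 - m / c)"
    have cpos: "c > 0"
      using c m(1) K(1) by (smt (verit) c\<^sub>0_def divide_nonneg_pos zero_le_power2)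
    have "m \<le> c"
      using c m(1) by (smt (verit) c\<^sub>0_def divide_nonneg_pos zero_le_power2)
    have Kc: "K^2 \<le> m * c"
      using c m(1) by (simp add: c\<^sub>0_def field_simps) (smt (verit) mult_pos_pos)
    have r: "0 \<le> r" "r < 1" "r^2 = 1 - m / c"
      using cpos m(1) \<open>m \<le> c\<close> by (auto simp: r_def)
    have A: "norm (A *v x) \<le> r * norm x" for x
    proof (rule power2_le_imp_le)
      have Ax: "A *v x = x - (1/c) *\<^sub>R (P *v x)"
        by (simp add: A_def matrix_vector_mult_diff_rdistrib scaleR_matrix_vector_mult)
      have "(norm (A *v x))^2 = (norm x)^2 - 2 / c * (x \<bullet> (P *v x)) + (norm (P *v x))^2 / c^2"
        unfolding Ax power2_norm_eq_inner
        by (simp add: inner_diff_left inner_diff_right inner_commute power2_eq_square)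
      moreover have "(norm (P *v x))^2 / c^2 \<le> m / c * (norm x)^2"
      proof -
        have "(norm (P *v x))^2 / c^2 \<le> (norm x * K)^2 / c^2"
          by (intro divide_right_mono power_mono K) auto
        also have "\<dots> \<le> (norm x)^2 * (m * c) / c^2"
          using Kc by (simp add: power_mult_distrib divide_right_mono mult_left_mono)
        also have "\<dots> = m / c * (norm x)^2"
          using cpos by (simp add: power2_eq_square)
        finally show ?thesis .
      qed
      moreover have "2 / c * (m * (norm x)^2) \<le> 2 / c * (x \<bullet> (P *v x))"
        by (intro mult_left_mono m) (use cpos in auto)
      moreover have "2 / c * (m * (norm x)^2) = 2 * (m / c * (norm x)^2)"
        by simp
      ultimately have "(norm (A *v x))^2 \<le> (norm x)^2 - m / c * (norm x)^2"
        by linarith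
      then have "(norm (A *v x))^2 \<le> (1 - m / c) * (norm x)^2"
        by (simp add: left_diff_distrib)
      then show "(norm (A *v x))^2 \<le> (r * norm x)^2"
        by (simp add: power_mult_distrib r)
    qed (use r in auto)
    have hP: "conj_transpose P = P" using P by (simp add: posdef_def)
    have hA: "conj_transpose A = A"
      by (simp add: A_def conj_transpose_diff conj_transpose_scaleR hP)
    obtain Y where Y: "sqrt_iter A \<longlonglongrightarrow> Y" "conj_transpose Y = Y" "Y + Y = A + Y ** Y"
      "\<And>x. norm (Y *v x) \<le> r * norm x"
      using sqrt_iter_limit[OF r(1,2) A hA] by metis
    define X where "X = sqrt c *\<^sub>R (mat 1 - Y)"
    have "posdef X"
      unfolding posdef_def
    proof (intro conjI allI impI)
      show "conj_transpose X = X"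
        by (simp add: X_def conj_transpose_scaleR conj_transpose_diff Y)
      fix x :: "complex^'k" assume "x \<noteq> 0"
      \<comment> \<open>Cauchy-Schwarz and the strict inequality r < 1 make 1 - Y positive
        definite.\<close>
      have "x \<bullet> (Y *v x) \<le> norm x * (r * norm x)"
        by (meson Cauchy_Schwarz_ineq2 Y(4) abs_le_D1 mult_left_mono norm_ge_zero order_trans)
      also have "\<dots> < 1 * (norm x)^2"
        using r \<open>x \<noteq> 0\<close> by (simp add: power2_eq_square)
      finally have "0 < x \<bullet> (x - Y *v x)"
        by (simp add: inner_diff_right power2_norm_eq_inner)
      then show "0 < x \<bullet> (X *v x)"
        using cpos by (simp add: X_def scaleR_matrix_vector_mult matrix_vector_mult_diff_rdistrib)
    qed
    moreover have "X ** X = P"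
    proof -
      have "(mat 1 - Y) ** (mat 1 - Y) = mat 1 - (Y + Y) + Y ** Y"
        by (simp add: matrix_diff_ldistrib matrix_diff_rdistrib)
      also have "\<dots> = mat 1 - A"
        by (simp add: Y(3))
      finally have *: "(mat 1 - Y) ** (mat 1 - Y) = (1/c) *\<^sub>R P"
        by (simp add: A_def)
      have "X ** X = (sqrt c * sqrt c) *\<^sub>R ((mat 1 - Y) ** (mat 1 - Y))"
        by (simp add: X_def scalar_matrix_assoc[symmetric] matrix_scalar_ac)
      then show ?thesis
        using cpos by (simp add: *)
    qed
    ultimately have "psd_sqrt P = X"
      by (rule psd_sqrt_eqI)
    moreover have "(\<lambda>k. sqrt c *\<^sub>R (mat 1 - sqrt_iter A k)) \<longlonglongrightarrow> X"
      unfolding X_def by (intro tendsto_intros Y)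
    ultimately show ?thesis
      using \<open>posdef X\<close> \<open>X ** X = P\<close> by (simp add: A_def)
  qed
  show "posdef (psd_sqrt P)" "psd_sqrt P ** psd_sqrt P = P"
    using main[OF order_refl] by simp_all
  show "\<exists>c\<^sub>0. \<forall>c\<ge>c\<^sub>0.
      (\<lambda>k. sqrt c *\<^sub>R (mat 1 - sqrt_iter (mat 1 - (1/c) *\<^sub>R P) k)) \<longlonglongrightarrow> psd_sqrt P"
    using main by (intro exI[of _ c\<^sub>0]) simp
qed

section \<open>Block matrices\<close>

text \<open>A two-sided inverse is unique, which pins down the choice made in
  \<open>matrix_inv\<close>. The two index types differ so that the lemma applies to
  \<open>V\<close>, whose rows and columns are indexed by different types.\<close>

lemma matrix_inv_eqI:
  fixes A :: "complex^'n^'m" and B :: "complex^'m^'n"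
  assumes "A ** B = mat 1" "B ** A = mat 1"
  shows "matrix_inv A = B"
  unfolding matrix_inv_def
proof (rule some_equality)
  show "A ** B = mat 1 \<and> B ** A = mat 1" using assms by simp
  show "C = B" if "A ** C = mat 1 \<and> C ** A = mat 1" for C
    by (metis assms(1) that matrix_mul_assoc matrix_mul_lid matrix_mul_rid)
qed

lemma matrix_inv_mult_cancel:
  fixes A :: "complex^'n^'n"
  assumes "invertible A"
  shows "matrix_inv A ** A = mat 1" "A ** matrix_inv A = mat 1"
    "B ** matrix_inv A ** A = B" "C ** A ** matrix_inv A = C"
proof -
  obtain A' where A': "A ** A' = mat 1" "A' ** A = mat 1"
    using assms by (auto simp: invertible_def)
  then show 1: "matrix_inv A ** A = mat 1" and 2: "A ** matrix_inv A = mat 1"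
    by (simp_all add: matrix_inv_eqI)
  show "B ** matrix_inv A ** A = B" "C ** A ** matrix_inv A = C"
    by (simp_all add: 1 2 matrix_mul_assoc[symmetric])
qed

lemma matrix_inv_unitary: "unitary_matrix V \<Longrightarrow> matrix_inv V = conj_transpose V"
  by (simp add: matrix_inv_eqI unitary_matrix_def)

lemma sum_UNIV_Plus:
  fixes f :: "'p::finite + 'q::finite \<Rightarrow> 'a::comm_monoid_add"
  shows "sum f UNIV = (\<Sum>i\<in>UNIV. f (Inl i)) + (\<Sum>j\<in>UNIV. f (Inr j))"
  by (simp add: UNIV_Plus_UNIV[symmetric] sum.Plus[OF finite finite] o_def del: UNIV_Plus_UNIV)


definition block_vec :: "complex^'p \<Rightarrow> complex^'q \<Rightarrow> complex^('p::finite + 'q::finite)" where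
  "block_vec a b = (\<chi> k. case k of Inl i \<Rightarrow> a $ i | Inr j \<Rightarrow> b $ j)"

lemma block_vec_nth [simp]: "block_vec a b $ Inl i = a $ i" "block_vec a b $ Inr j = b $ j"
  by (simp_all add: block_vec_def)

lemma inner_block_vec:
  "block_vec a b \<bullet> x = a \<bullet> (\<chi> i. x $ Inl i) + b \<bullet> (\<chi> j. x $ Inr j)"
  by (simp add: inner_vec_def sum_UNIV_Plus)

text \<open>Positivity of the whole matrix is passed to its blocks through test vectors: a = 0 gives
  the lower right block, and a suitable b depending on a gives the Schur complement.\<close>

lemma unitary_block_form:
  fixes V :: "complex^('p::finite + 'q::finite)^'n"
  assumes "unitary_matrix V"
  shows "(V *v block_vec a b) \<bullet> (A *v (V *v block_vec a b)) =
    a \<bullet> (block11 V A *v a) + a \<bullet> (block12 V A *v b) + b \<bullet> (block21 V A *v a) + b \<bullet> (block22 V A *v b)"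
proof -
  define M where "M = matrix_inv V ** A ** V"
  have "(V *v block_vec a b) \<bullet> (A *v (V *v block_vec a b)) = block_vec a b \<bullet> (M *v block_vec a b)"
    using inner_matrix_vector_mult[of "block_vec a b" "conj_transpose V" "A *v (V *v block_vec a b)"]
    by (simp add: M_def matrix_inv_unitary[OF assms] matrix_vector_mul_assoc matrix_mul_assoc)
  moreover have "(\<chi> i. (M *v block_vec a b) $ Inl i) = block11 V A *v a + block12 V A *v b"
    by (simp add: vec_eq_iff matrix_vector_mult_def sum_UNIV_Plus block11_def block12_def M_def)
  moreover have "(\<chi> i. (M *v block_vec a b) $ Inr i) = block21 V A *v a + block22 V A *v b"
    by (simp add: vec_eq_iff matrix_vector_mult_def sum_UNIV_Plus block21_def block22_def M_def)
  ultimately show ?thesis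
    by (simp add: inner_block_vec inner_add_right)
qed

lemma conj_transpose_blocks:
  assumes "unitary_matrix V"
  shows "conj_transpose (block11 V A) = block11 V (conj_transpose A)"
    "conj_transpose (block12 V A) = block21 V (conj_transpose A)"
    "conj_transpose (block21 V A) = block12 V (conj_transpose A)"
    "conj_transpose (block22 V A) = block22 V (conj_transpose A)"
proof -
  have "conj_transpose (conj_transpose V ** A ** V) = conj_transpose V ** conj_transpose A ** V"
    by (simp add: conj_transpose_mult matrix_mul_assoc)
  then have "cnj ((conj_transpose V ** A ** V) $ i $ j) = (conj_transpose V ** conj_transpose A ** V) $ j $ i" for i j
    by (metis conj_transpose_nth)
  then show "conj_transpose (block11 V A) = block11 V (conj_transpose A)"
    "conj_transpose (block12 V A) = block21 V (conj_transpose A)"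
    "conj_transpose (block21 V A) = block12 V (conj_transpose A)"
    "conj_transpose (block22 V A) = block22 V (conj_transpose A)"
    by (simp_all add: vec_eq_iff matrix_inv_unitary[OF assms] block11_def block12_def block21_def block22_def)
qed

lemma map_matrix_mult_left: "map_matrix ((*) z) A ** B = map_matrix ((*) z) (A ** B)"
  and map_matrix_mult_right: "A ** map_matrix ((*) z) B = map_matrix ((*) z) (A ** B)"
  for z :: complex
  by (simp_all add: vec_eq_iff matrix_matrix_mult_def sum_distrib_left mult_ac)

lemma map_matrix_vector_mult: "map_matrix ((*) z) A *v x = z *s (A *v x)"
  for z :: complex
  by (simp add: vec_eq_iff matrix_vector_mult_def sum_distrib_left mult_ac)

lemma blocks_diff_smult:
  shows "block11 V (A - map_matrix ((*) z) B) = block11 V A - map_matrix ((*) z) (block11 V B)"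
    "block12 V (A - map_matrix ((*) z) B) = block12 V A - map_matrix ((*) z) (block12 V B)"
    "block21 V (A - map_matrix ((*) z) B) = block21 V A - map_matrix ((*) z) (block21 V B)"
    "block22 V (A - map_matrix ((*) z) B) = block22 V A - map_matrix ((*) z) (block22 V B)"
  by (simp_all add: vec_eq_iff block11_def block12_def block21_def block22_def
      matrix_diff_ldistrib matrix_diff_rdistrib map_matrix_mult_left map_matrix_mult_right)

lemma block_vec_eq_0_iff: "block_vec a b = 0 \<longleftrightarrow> a = 0 \<and> b = 0"
  by (metis block_vec_nth vec_eq_iff zero_index sumE)

lemma unitary_vector_eq_0_iff: "unitary_matrix V \<Longrightarrow> V *v x = 0 \<longleftrightarrow> x = 0"
  by (metis matrix_vector_mul_assoc matrix_vector_mul_lid matrix_vector_mult_0_right unitary_matrix_def)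

lemma posdef_block22:
  assumes "unitary_matrix V" "posdef W"
  shows "posdef (block22 V W)"
  unfolding posdef_def
proof (intro conjI allI impI)
  show "conj_transpose (block22 V W) = block22 V W"
    using assms by (simp add: conj_transpose_blocks posdef_def)
  fix b :: "complex^'b" assume "b \<noteq> 0"
  then have "V *v block_vec 0 b \<noteq> 0"
    by (simp add: assms unitary_vector_eq_0_iff block_vec_eq_0_iff)
  then have "0 < (V *v block_vec 0 b) \<bullet> (W *v (V *v block_vec 0 b))"
    using assms(2) by (simp add: posdef_def)
  then show "0 < b \<bullet> (block22 V W *v b)"
    by (simp add: unitary_block_form[OF assms(1)])
qed

lemma conj_transpose_matrix_inv:
  assumes "invertible S" "conj_transpose S = S"
  shows "conj_transpose (matrix_inv S) = matrix_inv S"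
proof (rule matrix_inv_eqI[symmetric])
  have "conj_transpose (matrix_inv S ** S) = mat 1" "conj_transpose (S ** matrix_inv S) = mat 1"
    using assms(1) by (simp_all add: matrix_inv_mult_cancel)
  then show "S ** conj_transpose (matrix_inv S) = mat 1" "conj_transpose (matrix_inv S) ** S = mat 1"
    by (simp_all add: conj_transpose_mult assms(2))
qed

section \<open>Hermitian pencils and their resolvents\<close>

lemma inner_imult_left: "(\<i> *s x) \<bullet> y = - (x \<bullet> (\<i> *s y))"
  for x y :: "complex^'n"
  by (simp add: inner_vec_def inner_complex_def sum_negf[symmetric])

lemma norm_imult [simp]: "norm (\<i> *s x) = norm x"
  for x :: "complex^'n"
  by (simp add: norm_vec_def norm_mult)

text \<open>\<open>A\<close> can be moved across the inner product and commutes with multiplication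
  by the imaginary unit, which is skew for the real inner product; hence the pairing equals its own
  negative.\<close>

lemma hermitian_inner_imult:
  assumes "conj_transpose A = A"
  shows "(A *v x) \<bullet> (\<i> *s x) = 0"
proof -
  have "(A *v x) \<bullet> (\<i> *s x) = x \<bullet> (\<i> *s (A *v x))"
    using inner_matrix_vector_mult[of x A "\<i> *s x"] assms by (simp add: vector_scalar_commute)
  also have "\<dots> = - ((A *v x) \<bullet> (\<i> *s x))"
    using inner_imult_left[of x "A *v x"] by (simp add: inner_commute)
  finally show ?thesis by simp
qed

text \<open>Pairing with \<open>\<i> x\<close> extracts the imaginary part of the quadratic form.\<close>

lemma pencil_inner_imult:
  assumes "conj_transpose H = H" "conj_transpose W = W"
  shows "((H - map_matrix ((*) z) W) *v x) \<bullet> (\<i> *s x) = - (Im z * (x \<bullet> (W *v x)))"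
proof -
  \<comment> \<open>The real part of z contributes another Hermitian term, whose pairing vanishes;
    only the imaginary part survives.\<close>
  have z: "z *s y = Re z *\<^sub>R y + Im z *\<^sub>R (\<i> *s y)" for y :: "complex^'a"
    by (simp add: vec_eq_iff complex_eq_iff)
  have "(\<i> *s y) \<bullet> (\<i> *s x) = y \<bullet> x" for y
    by (simp add: inner_vec_def inner_complex_def add.commute)
  then show ?thesis
    by (simp add: matrix_vector_mult_diff_rdistrib map_matrix_vector_mult z inner_diff_left inner_add_left
        hermitian_inner_imult assms) (simp add: inner_commute)
qed

text \<open>On a kernel vector the imaginary part of the quadratic form is zero, yet it is a nonzero
  multiple of the form of \<open>W\<close>.\<close>

lemma pencil_invertible:
  assumes "conj_transpose H = H" "posdef W" "Im z \<noteq> 0"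
  shows "invertible (H - map_matrix ((*) z) W)"
proof (rule invertible_if_kernel_trivial)
  fix x assume "(H - map_matrix ((*) z) W) *v x = 0"
  then have "x \<bullet> (W *v x) = 0"
    using pencil_inner_imult[of H W z x] assms by (simp add: posdef_def)
  then show "x = 0"
    using assms(2) unfolding posdef_def by (metis less_irrefl)
qed

text \<open>The usual resolvent estimate, obtained without inverting the root S: for A v = S x and u
  = S v, pairing with \<open>\<i> *s v\<close> gives |Im z| |u|^2 = |x . (i u)| <= |x| |u|.\<close>

lemma pencil_resolvent_bound:
  assumes H: "conj_transpose H = H" and W: "posdef W" and z: "Im z \<noteq> 0"
  shows "norm ((psd_sqrt W ** matrix_inv (H - map_matrix ((*) z) W) ** psd_sqrt W) *v x)
    \<le> 1 / \<bar>Im z\<bar> * norm x"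
proof -
  let ?S = "psd_sqrt W" and ?A = "H - map_matrix ((*) z) W"
  define v where "v = matrix_inv ?A *v (?S *v x)"
  define u where "u = ?S *v v"
  have S: "conj_transpose ?S = ?S" "?S ** ?S = W"
    using posdef_psd_sqrt[OF W] psd_sqrt_square[OF W] by (auto simp: posdef_def)
  have "?A *v v = ?S *v x"
    using pencil_invertible[OF H W z]
    by (simp add: v_def matrix_vector_mul_assoc matrix_mul_assoc matrix_inv_mult_cancel)
  then have "(?S *v x) \<bullet> (\<i> *s v) = - (Im z * (v \<bullet> (W *v v)))"
    using pencil_inner_imult[of H W z v] H W by (simp add: posdef_def)
  moreover have "(?S *v x) \<bullet> (\<i> *s v) = x \<bullet> (\<i> *s u)"
    using inner_matrix_vector_mult[of x ?S "\<i> *s v"] by (simp add: S u_def vector_scalar_commute)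
  moreover have "v \<bullet> (W *v v) = (norm u)^2"
    using inner_matrix_vector_mult[of v ?S "?S *v v"]
    by (simp add: S u_def matrix_vector_mul_assoc power2_norm_eq_inner)
  ultimately have "\<bar>Im z\<bar> * (norm u)^2 = \<bar>x \<bullet> (\<i> *s u)\<bar>"
    by (simp add: abs_mult)
  also have "\<dots> \<le> norm x * norm u"
    using Cauchy_Schwarz_ineq2[of x "\<i> *s u"] by simp
  finally have "\<bar>Im z\<bar> * norm u \<le> norm x"
    by (cases "u = 0") (simp_all add: power2_eq_square)
  then have "norm u \<le> 1 / \<bar>Im z\<bar> * norm x"
    using z by (simp add: field_simps)
  then show ?thesis
    by (simp add: u_def v_def matrix_vector_mul_assoc matrix_mul_assoc)
qed

lemma matrix_inv_psd_sqrt: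
  assumes "posdef P"
  shows "matrix_inv P = matrix_inv (psd_sqrt P) ** matrix_inv (psd_sqrt P)"
proof (rule matrix_inv_eqI)
  let ?S = "psd_sqrt P"
  have "invertible ?S" by (simp add: assms posdef_invertible posdef_psd_sqrt)
  then have "?S ** ?S ** (matrix_inv ?S ** matrix_inv ?S) = mat 1"
    "matrix_inv ?S ** matrix_inv ?S ** (?S ** ?S) = mat 1"
    by (simp_all add: matrix_mul_assoc matrix_inv_mult_cancel)
  then show "P ** (matrix_inv ?S ** matrix_inv ?S) = mat 1" "matrix_inv ?S ** matrix_inv ?S ** P = mat 1"
    by (simp_all add: psd_sqrt_square[OF assms])
qed

section \<open>Off-diagonal blocks scaled by the inverse root\<close>

lemma mult_conj_transpose_diag:
  "Re ((T ** conj_transpose T) $ i $ i) = (\<Sum>j\<in>UNIV. (norm (T $ i $ j))^2)"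
  by (simp add: matrix_matrix_mult_def complex_mult_cnj cmod_power2)

text \<open>This is T for \<open>A = H\<close> and U for \<open>A = W\<close>. Splitting the inverse
  of \<open>block22 V W\<close> evenly into two inverse roots makes the product with the adjoint
  equal to the matrix in the integrability hypothesis.\<close>

definition scaled12 :: "complex^('p::finite + 'q::finite)^'n \<Rightarrow> complex^'n^'n \<Rightarrow> complex^'n^'n \<Rightarrow> complex^'q^'p" where
  "scaled12 V W A = block12 V A ** matrix_inv (psd_sqrt (block22 V W))"

lemma psd_sqrt_block22:
  assumes "unitary_matrix V" "posdef W"
  shows "invertible (psd_sqrt (block22 V W))"
    "conj_transpose (psd_sqrt (block22 V W)) = psd_sqrt (block22 V W)"
    "conj_transpose (matrix_inv (psd_sqrt (block22 V W))) = matrix_inv (psd_sqrt (block22 V W))"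
    "matrix_inv (block22 V W) = matrix_inv (psd_sqrt (block22 V W)) ** matrix_inv (psd_sqrt (block22 V W))"
proof -
  let ?S = "psd_sqrt (block22 V W)"
  have P: "posdef (block22 V W)" by (rule posdef_block22[OF assms])
  then have S: "posdef ?S" by (rule posdef_psd_sqrt)
  then show 1: "invertible ?S" and 2: "conj_transpose ?S = ?S"
    by (simp_all add: posdef_invertible) (simp add: posdef_def)
  show "conj_transpose (matrix_inv ?S) = matrix_inv ?S"
    by (rule conj_transpose_matrix_inv[OF 1 2])
  show "matrix_inv (block22 V W) = matrix_inv ?S ** matrix_inv ?S"
    by (rule matrix_inv_psd_sqrt[OF P])
qed

lemma conj_transpose_scaled12:
  assumes "unitary_matrix V" "posdef W" "conj_transpose A = A"
  shows "conj_transpose (scaled12 V W A) = matrix_inv (psd_sqrt (block22 V W)) ** block21 V A"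
  using assms by (simp add: scaled12_def conj_transpose_mult psd_sqrt_block22 conj_transpose_blocks)

lemma scaled12_mult_conj_transpose:
  assumes "unitary_matrix V" "posdef W" "conj_transpose A = A"
  shows "scaled12 V W A ** conj_transpose (scaled12 V W A) =
    block12 V A ** matrix_inv (block22 V W) ** block21 V A"
  by (simp add: conj_transpose_scaled12[OF assms] psd_sqrt_block22(4)[OF assms(1,2)] matrix_mul_assoc)
    (simp add: scaled12_def)

text \<open>This is nonnegativity of the Schur complement of \<open>W\<close>, read on the diagonal:
  \<open>W\<close> is tested on the vector with upper part the i-th unit vector and lower part
  minimising the form.\<close>

lemma scaled12_self_bound:
  assumes V: "unitary_matrix V" and W: "posdef W"
  shows "Re ((scaled12 V W W ** conj_transpose (scaled12 V W W)) $ i $ i) \<le> Re (block11 V W $ i $ i)"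
proof -
  let ?S = "psd_sqrt (block22 V W)" and ?U = "scaled12 V W W"
  define a where "a = axis i (1::complex)"
  define u where "u = conj_transpose ?U *v a"
  \<comment> \<open>In terms of the blocks of W, b = - W22^{-1} W21 a. Both cross terms of the form
    then equal - |u|^2 and the last term equals |u|^2, leaving a . W11 a - |u|^2.\<close>
  define b where "b = - (matrix_inv ?S *v u)"
  have hW: "conj_transpose W = W" using W by (simp add: posdef_def)
  note S = psd_sqrt_block22[OF V W]
  have Sb: "?S *v b = - u"
    using S(1) by (simp add: b_def matrix_vector_mul_assoc matrix_inv_mult_cancel vec.neg)
  have W21: "block21 V W *v a = ?S *v u"
    using S(1) by (simp add: u_def conj_transpose_scaled12[OF V W hW] matrix_vector_mul_assoc
        matrix_mul_assoc matrix_inv_mult_cancel)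
  have Sx: "b \<bullet> (?S *v y) = - (u \<bullet> y)" for y
    using inner_matrix_vector_mult[of b ?S y] S(2) Sb by simp
  have 1: "b \<bullet> (block21 V W *v a) = - (u \<bullet> u)"
    by (simp add: W21 Sx)
  have 2: "a \<bullet> (block12 V W *v b) = - (u \<bullet> u)"
    using inner_matrix_vector_mult[of a "block12 V W" b] 1
    by (simp add: conj_transpose_blocks[OF V] hW inner_commute)
  have "block22 V W *v b = ?S *v (?S *v b)"
    by (simp add: matrix_vector_mul_assoc psd_sqrt_square[OF posdef_block22[OF V W]])
  then have 3: "b \<bullet> (block22 V W *v b) = u \<bullet> u"
    by (simp add: Sx Sb)
  have "0 \<le> (V *v block_vec a b) \<bullet> (W *v (V *v block_vec a b))"
    using posdef_imp_psd[OF W] by (simp add: psd_iff_inner)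
  then have "u \<bullet> u \<le> a \<bullet> (block11 V W *v a)"
    by (simp add: unitary_block_form[OF V] 1 2 3)
  also have "\<dots> = Re (block11 V W $ i $ i)"
    by (simp add: a_def inner_axis' matrix_vector_mult_axis inner_complex_def)
  also have "u \<bullet> u = a \<bullet> ((?U ** conj_transpose ?U) *v a)"
    using inner_matrix_vector_mult[of a "?U" u] by (simp add: u_def matrix_vector_mul_assoc)
  also have "\<dots> = Re ((?U ** conj_transpose ?U) $ i $ i)"
    by (simp add: a_def inner_axis' matrix_vector_mult_axis inner_complex_def)
  finally show ?thesis .
qed

text \<open>The pointwise algebra: inserting the root and its inverse next to the inverse of
  \<open>block22 V A\<close> turns every expression into one in B, R and B'. Here B = A12 S^{-1} and
  B' = S^{-1} A21; since z is not conjugated in A21, B' is in general not the adjoint of B.\<close>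

lemma index_1_identities:
  fixes V :: "complex^('p::finite + 'q::finite)^'n"
  assumes V: "unitary_matrix V" and W: "posdef W" and hH: "conj_transpose H = H"
    and z: "Im z \<noteq> 0"
  defines "A \<equiv> H - map_matrix ((*) z) W"
    and "S \<equiv> psd_sqrt (block22 V W)"
    and "B \<equiv> scaled12 V W H - map_matrix ((*) z) (scaled12 V W W)"
    and "B' \<equiv> conj_transpose (scaled12 V W H) - map_matrix ((*) z) (conj_transpose (scaled12 V W W))"
  defines "R \<equiv> S ** matrix_inv (block22 V A) ** S"
  shows "invertible (block22 V A)"
    and "norm (R *v x) \<le> 1 / \<bar>Im z\<bar> * norm x"
    and "block12 V A ** matrix_inv (block22 V A) ** S = B ** R"
    and "schur_complement V A = block11 V H - map_matrix ((*) z) (block11 V W) - B ** R ** B'"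
    and "S ** (matrix_inv (block22 V W) ** block21 V W - matrix_inv (block22 V A) ** block21 V A) =
      conj_transpose (scaled12 V W W) - R ** B'"
    and "schur_complement V W =
      block11 V W - scaled12 V W W ** conj_transpose (scaled12 V W W)"
proof -
  have hW: "conj_transpose W = W" using W by (simp add: posdef_def)
  have A22: "block22 V A = block22 V H - map_matrix ((*) z) (block22 V W)"
    by (simp add: A_def blocks_diff_smult)
  have h22: "conj_transpose (block22 V H) = block22 V H"
    by (simp add: conj_transpose_blocks[OF V] hH)
  show inv: "invertible (block22 V A)"
    unfolding A22 by (rule pencil_invertible[OF h22 posdef_block22[OF V W] z])
  show "norm (R *v x) \<le> 1 / \<bar>Im z\<bar> * norm x"
    unfolding R_def S_def A22 by (rule pencil_resolvent_bound[OF h22 posdef_block22[OF V W] z])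
  note S = psd_sqrt_block22[OF V W, folded S_def]
  note cancel = matrix_inv_mult_cancel[OF S(1)]
  have B: "B = block12 V A ** matrix_inv S"
    by (simp add: B_def A_def scaled12_def S_def blocks_diff_smult matrix_diff_rdistrib map_matrix_mult_left)
  have B': "B' = matrix_inv S ** block21 V A"
    by (simp add: B'_def conj_transpose_scaled12[OF V W] hW hH A_def S_def blocks_diff_smult
        matrix_diff_ldistrib map_matrix_mult_right)
  show "block12 V A ** matrix_inv (block22 V A) ** S = B ** R"
    by (simp add: B R_def matrix_mul_assoc cancel)
  have "B ** R ** B' = block12 V A ** matrix_inv (block22 V A) ** block21 V A"
    by (simp add: B B' R_def matrix_mul_assoc cancel)
  then show "schur_complement V A = block11 V H - map_matrix ((*) z) (block11 V W) - B ** R ** B'"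
    by (simp add: schur_complement_def) (simp add: A_def blocks_diff_smult)
  have "R ** B' = S ** matrix_inv (block22 V A) ** block21 V A"
    by (simp add: B' R_def matrix_mul_assoc cancel)
  moreover have "conj_transpose (scaled12 V W W) = S ** matrix_inv (block22 V W) ** block21 V W"
    by (simp add: conj_transpose_scaled12[OF V W hW] S(4) S_def[symmetric] matrix_mul_assoc cancel)
  ultimately show "S ** (matrix_inv (block22 V W) ** block21 V W - matrix_inv (block22 V A) ** block21 V A) =
      conj_transpose (scaled12 V W W) - R ** B'"
    by (simp add: matrix_diff_ldistrib matrix_mul_assoc)
  show "schur_complement V W =
      block11 V W - scaled12 V W W ** conj_transpose (scaled12 V W W)"
    by (simp add: schur_complement_def scaled12_mult_conj_transpose[OF V W hW])
qed

section \<open>Measurability\<close>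

lemma meas_on_UNIV: "meas_on UNIV = borel_measurable lebesgue"
  by (simp add: meas_on_def lebesgue_on_UNIV_eq)

lemma matrices_over_meas_UNIV:
  "A \<in> matrices_over (meas_on UNIV) \<longleftrightarrow> (\<forall>i j. (\<lambda>t. A t $ i $ j) \<in> borel_measurable lebesgue)"
  by (simp add: matrices_over_def meas_on_UNIV)

text \<open>One induction over the summation index serves all the product rules: only the scalar
  product rule and closure of the target under 0 and addition vary.\<close>

lemma matrices_over_mult:
  assumes A: "A \<in> matrices_over \<A>" and B: "B \<in> matrices_over \<B>"
    and mult: "\<And>f g. f \<in> \<A> \<Longrightarrow> g \<in> \<B> \<Longrightarrow> (\<lambda>t. f t * g t) \<in> \<C>"
    and add: "\<And>f g. f \<in> \<C> \<Longrightarrow> g \<in> \<C> \<Longrightarrow> (\<lambda>t. f t + g t) \<in> \<C>"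
    and zero: "(\<lambda>t. 0) \<in> \<C>"
  shows "(\<lambda>t. A t ** B t) \<in> matrices_over \<C>"
proof -
  have "(\<lambda>t. \<Sum>k\<in>K. A t $ i $ k * B t $ k $ j) \<in> \<C>" if "finite K" for K i j
    using that
    by induction (use A B in \<open>auto simp: matrices_over_def intro!: zero add mult\<close>)
  then show ?thesis
    by (simp add: matrices_over_def matrix_matrix_mult_def)
qed

lemma meas_matrix_const: "(\<lambda>t. C) \<in> matrices_over (meas_on UNIV)"
  by (simp add: matrices_over_meas_UNIV)

lemma meas_matrix_mult:
  "A \<in> matrices_over (meas_on UNIV) \<Longrightarrow> B \<in> matrices_over (meas_on UNIV) \<Longrightarrow>
    (\<lambda>t. A t ** B t) \<in> matrices_over (meas_on UNIV)"
  by (erule (1) matrices_over_mult) (auto simp: meas_on_UNIV)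

lemma meas_matrix_diff:
  "A \<in> matrices_over (meas_on UNIV) \<Longrightarrow> B \<in> matrices_over (meas_on UNIV) \<Longrightarrow>
    (\<lambda>t. A t - B t) \<in> matrices_over (meas_on UNIV)"
  by (auto simp: matrices_over_meas_UNIV intro!: borel_measurable_diff)

lemma meas_matrix_smult:
  "A \<in> matrices_over (meas_on UNIV) \<Longrightarrow> (\<lambda>t. map_matrix ((*) z) (A t)) \<in> matrices_over (meas_on UNIV)"
  by (auto simp: matrices_over_meas_UNIV intro!: borel_measurable_times)

lemma borel_measurable_det:
  assumes "\<And>i j. (\<lambda>t. A t $ i $ j) \<in> borel_measurable M"
  shows "(\<lambda>t. det (A t) :: complex) \<in> borel_measurable M"
  unfolding det_def
  by (intro borel_measurable_sum borel_measurable_times borel_measurable_const borel_measurable_prod assms)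

text \<open>On singular matrices \<^const>\<open>matrix_inv\<close> is a fixed arbitrary value.\<close>

lemma matrix_inv_cramer:
  fixes A :: "complex^'n^'n"
  shows "matrix_inv A $ i $ j =
    (if det A = 0 then (SOME X. False) $ i $ j
     else det (\<chi> a b. if b = i then axis j 1 $ a else A $ a $ b) / det A)"
proof (cases "det A = 0")
  case True
  then have "(\<lambda>X. A ** X = mat 1 \<and> X ** A = mat 1) = (\<lambda>X. False)"
    using invertible_det_nz[of A] by (auto simp: invertible_def fun_eq_iff)
  then show ?thesis
    using True by (simp add: matrix_inv_def)
next
  case False
  then have "A *v (matrix_inv A *v axis j 1) = axis j 1"
    by (simp add: matrix_vector_mul_assoc matrix_inv_mult_cancel invertible_det_nz)
  then have "matrix_inv A *v axis j 1 = (\<chi> k. det (\<chi> a b. if b = k then axis j 1 $ a else A $ a $ b) / det A)"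
    by (simp only: cramer[OF False])
  then show ?thesis
    using False matrix_vector_mult_axis[of "matrix_inv A" j i] by simp
qed

text \<open>Entries are quotients of determinants off the measurable set where the determinant
  vanishes, and constant on it, so measurability holds for singular values as well.\<close>

lemma meas_matrix_inv:
  fixes A :: "real \<Rightarrow> complex^'n^'n"
  assumes "A \<in> matrices_over (meas_on UNIV)"
  shows "(\<lambda>t. matrix_inv (A t)) \<in> matrices_over (meas_on UNIV)"
proof -
  have [measurable]: "(\<lambda>t. A t $ i $ j) \<in> borel_measurable lebesgue" for i j
    using assms by (simp add: matrices_over_meas_UNIV)
  have [measurable]: "(\<lambda>t. det (A t)) \<in> borel_measurable lebesgue"
    by (rule borel_measurable_det) measurable
  have [measurable]: "(\<lambda>t. det (\<chi> a b. if b = i then axis j 1 $ a else A t $ a $ b) :: complex)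
      \<in> borel_measurable lebesgue" for i j
    by (rule borel_measurable_det) simp
  show ?thesis
    unfolding matrices_over_meas_UNIV matrix_inv_cramer by measurable
qed

lemma matrices_over_AE:
  assumes "A \<in> matrices_over \<V>" "AE t in lebesgue. A t = B t"
    and "\<And>f g. f \<in> \<V> \<Longrightarrow> AE t in lebesgue. f t = g t \<Longrightarrow> g \<in> \<V>"
  shows "B \<in> matrices_over \<V>"
  unfolding matrices_over_def
proof (intro CollectI allI)
  fix i j
  have "AE t in lebesgue. A t $ i $ j = B t $ i $ j"
    using assms(2) by eventually_elim simp
  then show "(\<lambda>t. B t $ i $ j) \<in> \<V>"
    by (rule assms(3)[rotated]) (use assms(1) in \<open>simp add: matrices_over_def\<close>)
qed

text \<open>Completeness of Lebesgue measure.\<close>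

lemma meas_on_AE: "f \<in> meas_on UNIV \<Longrightarrow> AE t in lebesgue. f t = g t \<Longrightarrow> g \<in> meas_on UNIV"
  unfolding meas_on_UNIV by (rule borel_measurable_AE)

text \<open>\<open>lim\<close> is total, with a fixed value where the sequence diverges, so no
  convergence has to be assumed.\<close>

lemma meas_matrix_lim:
  fixes A :: "nat \<Rightarrow> real \<Rightarrow> complex^'m^'n"
  assumes "\<And>k. A k \<in> matrices_over (meas_on UNIV)"
  shows "(\<lambda>t. \<chi> i j. lim (\<lambda>k. A k t $ i $ j)) \<in> matrices_over (meas_on UNIV)"
  using assms unfolding matrices_over_meas_UNIV by (auto intro!: borel_measurable_lim_metric)

lemma matrix_limI:
  fixes A :: "nat \<Rightarrow> complex^'m^'n"
  assumes "A \<longlonglongrightarrow> L"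
  shows "(\<chi> i j. lim (\<lambda>k. A k $ i $ j)) = L"
  using tendsto_vec_nth[OF tendsto_vec_nth[OF assms]] by (simp add: vec_eq_iff limI)

lemma meas_sqrt_iter:
  assumes "A \<in> matrices_over (meas_on UNIV)"
  shows "(\<lambda>t. sqrt_iter (A t) k) \<in> matrices_over (meas_on UNIV)"
proof (induction k)
  case 0
  then show ?case by (simp add: meas_matrix_const)
next
  case (Suc k)
  then show ?case
    using assms meas_matrix_mult[OF Suc Suc]
    by (auto simp: matrices_over_meas_UNIV intro!: borel_measurable_scaleR borel_measurable_add)
qed

text \<open>The scaling \<open>c\<close> that makes the iteration converge depends on the matrix; letting \<open>c\<close> run
  through the natural numbers removes this dependence, as the limit is attained eventually.\<close>

lemma meas_psd_sqrt:
  fixes P :: "real \<Rightarrow> complex^'n^'n"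
  assumes P: "P \<in> matrices_over (meas_on UNIV)" and pos: "AE t in lebesgue. posdef (P t)"
  shows "(\<lambda>t. psd_sqrt (P t)) \<in> matrices_over (meas_on UNIV)"
proof -
  define X where "X c k t = sqrt (real c) *\<^sub>R (mat 1 - sqrt_iter (mat 1 - (1 / real c) *\<^sub>R P t) k)" for c k t
  define Y where "Y c t = (\<chi> i j. lim (\<lambda>k. X c k t $ i $ j))" for c t
  define Z where "Z t = (\<chi> i j. lim (\<lambda>c. Y c t $ i $ j))" for t
  have scaleR: "(\<lambda>t. r *\<^sub>R A t) \<in> matrices_over (meas_on UNIV)"
    if "A \<in> matrices_over (meas_on UNIV)" for r and A :: "real \<Rightarrow> complex^'n^'n"
    using that by (auto simp: matrices_over_meas_UNIV intro!: borel_measurable_scaleR)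
  have "X c k \<in> matrices_over (meas_on UNIV)" for c k
    unfolding X_def by (intro scaleR meas_matrix_diff meas_sqrt_iter meas_matrix_const P)
  then have "Z \<in> matrices_over (meas_on UNIV)"
    unfolding Z_def Y_def by (intro meas_matrix_lim)
  moreover have "AE t in lebesgue. Z t = psd_sqrt (P t)"
    using pos
  proof eventually_elim
    case (elim t)
    obtain c\<^sub>0 where c0: "\<And>c. c \<ge> c\<^sub>0 \<Longrightarrow>
        (\<lambda>k. sqrt c *\<^sub>R (mat 1 - sqrt_iter (mat 1 - (1/c) *\<^sub>R P t) k)) \<longlonglongrightarrow> psd_sqrt (P t)"
      using psd_sqrt_limit[OF elim] by blast
    have "Y c t = psd_sqrt (P t)" if "real c \<ge> c\<^sub>0" for c
      unfolding Y_def by (rule matrix_limI) (use c0[OF that] in \<open>simp add: X_def\<close>)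
    then have "\<forall>\<^sub>F c in sequentially. Y c t = psd_sqrt (P t)"
      by (intro eventually_mono[OF eventually_ge_at_top[of "nat \<lceil>c\<^sub>0\<rceil>"]]) (simp add: nat_ceiling_le_eq)
    then have "(\<lambda>c. Y c t) \<longlonglongrightarrow> psd_sqrt (P t)"
      by (rule tendsto_eventually)
    then show ?case
      unfolding Z_def by (rule matrix_limI)
  qed
  ultimately show ?thesis
    by (rule matrices_over_AE) (rule meas_on_AE)
qed

lemma meas_blocks:
  assumes A: "A \<in> matrices_over (meas_on UNIV)"
  shows "(\<lambda>t. block11 V (A t)) \<in> matrices_over (meas_on UNIV)"
    "(\<lambda>t. block12 V (A t)) \<in> matrices_over (meas_on UNIV)"
    "(\<lambda>t. block21 V (A t)) \<in> matrices_over (meas_on UNIV)"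
    "(\<lambda>t. block22 V (A t)) \<in> matrices_over (meas_on UNIV)"
proof -
  have "(\<lambda>t. matrix_inv V ** A t ** V) \<in> matrices_over (meas_on UNIV)"
    by (intro meas_matrix_mult meas_matrix_const A)
  then show "(\<lambda>t. block11 V (A t)) \<in> matrices_over (meas_on UNIV)"
    "(\<lambda>t. block12 V (A t)) \<in> matrices_over (meas_on UNIV)"
    "(\<lambda>t. block21 V (A t)) \<in> matrices_over (meas_on UNIV)"
    "(\<lambda>t. block22 V (A t)) \<in> matrices_over (meas_on UNIV)"
    by (simp_all add: matrices_over_meas_UNIV block11_def block12_def block21_def block22_def)
qed

section \<open>Local Lebesgue spaces on the line\<close>

lemma meas_on_subset: "f \<in> borel_measurable lebesgue \<Longrightarrow> f \<in> meas_on I"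
  by (simp add: meas_on_def measurable_restrict_space1)

lemma AE_lebesgue_on: "AE t in lebesgue. P t \<Longrightarrow> I \<in> sets lebesgue \<Longrightarrow> AE t in lebesgue_on I. P t"
  by (subst AE_restrict_space_iff) auto

lemma Lp_1_iff: "f \<in> Lp 1 I \<longleftrightarrow> f \<in> meas_on I \<and> integrable (lebesgue_on I) f"
  by (auto simp: Lp_def meas_on_def integrable_norm_iff)

lemma Lp_2_iff: "f \<in> Lp 2 I \<longleftrightarrow> f \<in> meas_on I \<and> integrable (lebesgue_on I) (\<lambda>t. (norm (f t))^2)"
  by (simp add: Lp_def)

lemma Lp_infty_iff: "f \<in> Lp top I \<longleftrightarrow> f \<in> meas_on I \<and> (\<exists>C. AE t in lebesgue_on I. norm (f t) \<le> C)"
  by (simp add: Lp_def)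

lemma Lp_loc_1_iff:
  "f \<in> Lp_loc 1 UNIV \<longleftrightarrow> f \<in> borel_measurable lebesgue \<and> (\<forall>a b. integrable (lebesgue_on {a..b}) f)"
proof -
  have "(\<forall>a b. a \<le> b \<longrightarrow> integrable (lebesgue_on {a..b}) f) \<longleftrightarrow>
      (\<forall>a b. integrable (lebesgue_on {a..b}) f)"
    by (metis atLeastatMost_empty_iff integrable_lebesgue_on_empty)
  then show ?thesis
    by (auto simp: Lp_loc_def Lp_1_iff meas_on_UNIV intro: meas_on_subset)
qed

lemma Lp_loc_2_iff:
  "f \<in> Lp_loc 2 UNIV \<longleftrightarrow>
    f \<in> borel_measurable lebesgue \<and> (\<forall>a b. integrable (lebesgue_on {a..b}) (\<lambda>t. (norm (f t))^2))"
proof -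
  have "(\<forall>a b. a \<le> b \<longrightarrow> integrable (lebesgue_on {a..b}) (\<lambda>t. (norm (f t))^2)) \<longleftrightarrow>
      (\<forall>a b. integrable (lebesgue_on {a..b}) (\<lambda>t. (norm (f t))^2))"
    by (metis atLeastatMost_empty_iff integrable_lebesgue_on_empty)
  then show ?thesis
    by (auto simp: Lp_loc_def Lp_2_iff meas_on_UNIV intro: meas_on_subset)
qed

lemma Lp_loc_inftyI:
  assumes "f \<in> borel_measurable lebesgue" "AE t in lebesgue. norm (f t) \<le> C"
  shows "f \<in> Lp_loc \<infinity> UNIV"
  using assms by (auto simp: Lp_loc_def Lp_infty_iff meas_on_UNIV meas_on_subset intro!: exI[of _ C] AE_lebesgue_on)

text \<open>The criterion by which integrable bounds become square integrability throughout.\<close>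

lemma Lp_loc_2_dominated:
  assumes f: "f \<in> borel_measurable lebesgue" and g: "g \<in> Lp_loc 1 UNIV"
    and le: "AE t in lebesgue. (norm (f t))^2 \<le> norm (g t)"
  shows "f \<in> Lp_loc 2 UNIV"
  unfolding Lp_loc_2_iff
proof (intro conjI allI f)
  fix a b :: real
  show "integrable (lebesgue_on {a..b}) (\<lambda>t. (norm (f t))^2)"
  proof (rule Bochner_Integration.integrable_bound)
    show "integrable (lebesgue_on {a..b}) g"
      using g by (simp add: Lp_loc_1_iff)
    show "(\<lambda>t. (norm (f t))^2) \<in> borel_measurable (lebesgue_on {a..b})"
      using f by (intro measurable_restrict_space1) simp
    show "AE t in lebesgue_on {a..b}. norm ((norm (f t))^2) \<le> norm (g t)"
      using le by (intro AE_lebesgue_on) auto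
  qed
qed

text \<open>The block identities hold only where W is positive definite and H Hermitian, so
  memberships must transfer along almost everywhere equality.\<close>

lemma Lp_loc_AE:
  assumes f: "f \<in> Lp_loc p UNIV" and eq: "AE t in lebesgue. f t = g t"
  shows "g \<in> Lp_loc p UNIV"
proof -
  have g: "g \<in> borel_measurable lebesgue"
    using f borel_measurable_AE[OF _ eq] by (simp add: Lp_loc_def meas_on_UNIV)
  have "g \<in> Lp p {a..b}" if fp: "f \<in> Lp p {a..b}" for a b
  proof -
    have eq': "AE t in lebesgue_on {a..b}. f t = g t"
      using eq by (intro AE_lebesgue_on) auto
    have m: "f \<in> borel_measurable (lebesgue_on {a..b})" "g \<in> borel_measurable (lebesgue_on {a..b})"
      using f g by (auto simp: Lp_loc_def meas_on_UNIV intro: measurable_restrict_space1)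
    show ?thesis
    proof (cases "p = \<infinity>")
      case True
      then obtain C where "AE t in lebesgue_on {a..b}. norm (f t) \<le> C"
        using fp True by (auto simp: Lp_infty_iff)
      then have "AE t in lebesgue_on {a..b}. norm (g t) \<le> C"
        using eq' by eventually_elim simp
      then show ?thesis
        using True m by (auto simp: Lp_infty_iff meas_on_def)
    next
      case False
      have "integrable (lebesgue_on {a..b}) (\<lambda>t. norm (f t) powr enn2real p)"
        using that False by (simp add: Lp_def)
      then have "integrable (lebesgue_on {a..b}) (\<lambda>t. norm (g t) powr enn2real p)"
        by (rule integrable_cong_AE_imp) (use m eq' in auto)
      then show ?thesis
        using False m by (simp add: Lp_def meas_on_def)
    qed
  qed
  then show ?thesis
    using f g by (auto simp: Lp_loc_def meas_on_UNIV)
qed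

lemma Lp_loc_1_add: "f \<in> Lp_loc 1 UNIV \<Longrightarrow> g \<in> Lp_loc 1 UNIV \<Longrightarrow> (\<lambda>t. f t + g t) \<in> Lp_loc 1 UNIV"
  by (auto simp: Lp_loc_1_iff)

lemma Lp_loc_1_diff: "f \<in> Lp_loc 1 UNIV \<Longrightarrow> g \<in> Lp_loc 1 UNIV \<Longrightarrow> (\<lambda>t. f t - g t) \<in> Lp_loc 1 UNIV"
  by (auto simp: Lp_loc_1_iff)

lemma zero_in_Lp_loc: "(\<lambda>t. 0) \<in> Lp_loc 1 UNIV" "(\<lambda>t. 0) \<in> Lp_loc 2 UNIV"
  by (simp_all add: Lp_loc_1_iff Lp_loc_2_iff)

lemma Lp_loc_1_smult: "f \<in> Lp_loc 1 UNIV \<Longrightarrow> (\<lambda>t. z * f t) \<in> Lp_loc 1 UNIV"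
  by (auto simp: Lp_loc_1_iff)

lemma Lp_loc_1_norm_power2: "f \<in> Lp_loc 2 UNIV \<Longrightarrow> (\<lambda>t. of_real ((norm (f t))^2)) \<in> Lp_loc 1 UNIV"
  by (auto simp: Lp_loc_2_iff Lp_loc_1_iff simp del: of_real_power)

text \<open>From |x - y|^2 <= 2 (|x|^2 + |y|^2); the bound is written as a complex function because
  \<open>Lp_loc\<close> contains only such.\<close>

lemma Lp_loc_2_diff:
  assumes f: "f \<in> Lp_loc 2 UNIV" and g: "g \<in> Lp_loc 2 UNIV"
  shows "(\<lambda>t. f t - g t) \<in> Lp_loc 2 UNIV"
proof (rule Lp_loc_2_dominated)
  show "(\<lambda>t. f t - g t) \<in> borel_measurable lebesgue"
    using f g by (auto simp: Lp_loc_2_iff)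
  show "(\<lambda>t. 2 * (of_real ((norm (f t))^2) + of_real ((norm (g t))^2))) \<in> Lp_loc 1 UNIV"
    by (intro Lp_loc_1_smult Lp_loc_1_add Lp_loc_1_norm_power2 f g)
  have "(norm (x - y))^2 \<le> norm (2 * (of_real ((norm x)^2) + of_real ((norm y)^2)) :: complex)" for x y :: complex
  proof -
    have "(norm (x - y))^2 \<le> (norm x + norm y)^2"
      by (intro power_mono norm_triangle_ineq4) simp
    also have "\<dots> \<le> 2 * ((norm x)^2 + (norm y)^2)"
      using sum_squares_bound[of "norm x" "norm y"] by (simp add: power2_sum)
    also have "\<dots> = norm (of_real (2 * ((norm x)^2 + (norm y)^2)) :: complex)"
      unfolding norm_of_real by simp
    finally show ?thesis by simp
  qed
  then show "AE t in lebesgue. (norm (f t - g t))^2 \<le>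
      norm (2 * (of_real ((norm (f t))^2) + of_real ((norm (g t))^2)) :: complex)"
    by simp
qed

lemma Lp_loc_2_smult: "f \<in> Lp_loc 2 UNIV \<Longrightarrow> (\<lambda>t. z * f t) \<in> Lp_loc 2 UNIV"
  by (auto simp: Lp_loc_2_iff norm_mult power_mult_distrib)

lemma Lp_loc_2_add: "f \<in> Lp_loc 2 UNIV \<Longrightarrow> g \<in> Lp_loc 2 UNIV \<Longrightarrow> (\<lambda>t. f t + g t) \<in> Lp_loc 2 UNIV"
  using Lp_loc_2_diff[of f "\<lambda>t. (-1) * g t"] Lp_loc_2_smult[of g "-1"] by simp

lemma Lp_loc_2_times_2:
  assumes f: "f \<in> Lp_loc 2 UNIV" and g: "g \<in> Lp_loc 2 UNIV"
  shows "(\<lambda>t. f t * g t) \<in> Lp_loc 1 UNIV"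
  unfolding Lp_loc_1_iff
proof (intro conjI allI)
  have meas: "(\<lambda>t. f t * g t) \<in> borel_measurable lebesgue"
    using f g by (auto simp: Lp_loc_2_iff)
  then show "(\<lambda>t. f t * g t) \<in> borel_measurable lebesgue" .
  fix a b :: real
  show "integrable (lebesgue_on {a..b}) (\<lambda>t. f t * g t)"
  proof (rule Bochner_Integration.integrable_bound)
    show "integrable (lebesgue_on {a..b}) (\<lambda>t. (norm (f t))^2 + (norm (g t))^2)"
      using f g by (simp add: Lp_loc_2_iff)
    show "(\<lambda>t. f t * g t) \<in> borel_measurable (lebesgue_on {a..b})"
      using meas by (rule measurable_restrict_space1)
    have "norm (x * y) \<le> norm ((norm x)^2 + (norm y)^2)" for x y :: complex
    proof -
      have "norm x * norm y \<le> (norm x)^2 + (norm y)^2"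
        using sum_squares_bound[of "norm x" "norm y"] mult_nonneg_nonneg[of "norm x" "norm y"]
          norm_ge_zero[of x] norm_ge_zero[of y] by linarith
      then show ?thesis
        by (simp add: norm_mult)
    qed
    then show "AE t in lebesgue_on {a..b}. norm (f t * g t) \<le> norm ((norm (f t))^2 + (norm (g t))^2)"
      by simp
  qed
qed

lemma Lp_loc_2_times_infty:
  assumes f: "f \<in> Lp_loc 2 UNIV" and g: "g \<in> Lp_loc \<infinity> UNIV"
  shows "(\<lambda>t. f t * g t) \<in> Lp_loc 2 UNIV"
  unfolding Lp_loc_2_iff
proof (intro conjI allI)
  have meas: "(\<lambda>t. f t * g t) \<in> borel_measurable lebesgue"
    using f g by (auto simp: Lp_loc_def meas_on_UNIV)
  then show "(\<lambda>t. f t * g t) \<in> borel_measurable lebesgue" .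
  fix a b :: real
  show "integrable (lebesgue_on {a..b}) (\<lambda>t. (norm (f t * g t))^2)"
  \<comment> \<open>An essential bound is available only on intervals with a <= b; otherwise the
    interval is empty.\<close>
  proof (cases "a \<le> b")
    case True
    then obtain C where C: "AE t in lebesgue_on {a..b}. norm (g t) \<le> C"
      using g by (auto simp: Lp_loc_def Lp_infty_iff)
    show ?thesis
    proof (rule Bochner_Integration.integrable_bound)
      show "integrable (lebesgue_on {a..b}) (\<lambda>t. C^2 * (norm (f t))^2)"
        using f by (simp add: Lp_loc_2_iff)
      show "(\<lambda>t. (norm (f t * g t))^2) \<in> borel_measurable (lebesgue_on {a..b})"
        using meas by (intro measurable_restrict_space1) simp
      show "AE t in lebesgue_on {a..b}. norm ((norm (f t * g t))^2) \<le> norm (C^2 * (norm (f t))^2)"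
        using C
      proof eventually_elim
        case (elim t)
        then have "(norm (g t))^2 \<le> C^2"
          by (intro power_mono) auto
        then show ?case
          by (simp add: norm_mult power_mult_distrib mult.commute[of "C^2"] mult_left_mono)
      qed
    qed
  qed simp
qed

section \<open>Matrix products between the local spaces\<close>

lemma Lp_loc_matrix_2_times_2:
  "A \<in> matrices_over (Lp_loc 2 UNIV) \<Longrightarrow> B \<in> matrices_over (Lp_loc 2 UNIV) \<Longrightarrow>
    (\<lambda>t. A t ** B t) \<in> matrices_over (Lp_loc 1 UNIV)"
  by (erule (1) matrices_over_mult) (blast intro: Lp_loc_2_times_2 Lp_loc_1_add zero_in_Lp_loc)+

lemma Lp_loc_matrix_2_times_infty:
  "A \<in> matrices_over (Lp_loc 2 UNIV) \<Longrightarrow> B \<in> matrices_over (Lp_loc \<infinity> UNIV) \<Longrightarrow>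
    (\<lambda>t. A t ** B t) \<in> matrices_over (Lp_loc 2 UNIV)"
  by (erule (1) matrices_over_mult) (blast intro: Lp_loc_2_times_infty Lp_loc_2_add zero_in_Lp_loc)+

lemma Lp_loc_matrix_infty_times_2:
  assumes "A \<in> matrices_over (Lp_loc \<infinity> UNIV)" "B \<in> matrices_over (Lp_loc 2 UNIV)"
  shows "(\<lambda>t. A t ** B t) \<in> matrices_over (Lp_loc 2 UNIV)"
  using assms
proof (rule matrices_over_mult)
  show "(\<lambda>t. f t * g t) \<in> Lp_loc 2 UNIV" if "f \<in> Lp_loc \<infinity> UNIV" "g \<in> Lp_loc 2 UNIV" for f g
    using Lp_loc_2_times_infty[OF that(2,1)] by (simp add: mult.commute)
qed (blast intro: Lp_loc_2_add zero_in_Lp_loc)+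

lemma Lp_loc_matrix_1_diff:
  "A \<in> matrices_over (Lp_loc 1 UNIV) \<Longrightarrow> B \<in> matrices_over (Lp_loc 1 UNIV) \<Longrightarrow>
    (\<lambda>t. A t - B t) \<in> matrices_over (Lp_loc 1 UNIV)"
  by (simp add: matrices_over_def Lp_loc_1_diff)

lemma Lp_loc_matrix_1_smult:
  "A \<in> matrices_over (Lp_loc 1 UNIV) \<Longrightarrow> (\<lambda>t. map_matrix ((*) z) (A t)) \<in> matrices_over (Lp_loc 1 UNIV)"
  by (simp add: matrices_over_def Lp_loc_1_smult)

lemma Lp_loc_matrix_2_diff:
  "A \<in> matrices_over (Lp_loc 2 UNIV) \<Longrightarrow> B \<in> matrices_over (Lp_loc 2 UNIV) \<Longrightarrow>
    (\<lambda>t. A t - B t) \<in> matrices_over (Lp_loc 2 UNIV)"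
  by (simp add: matrices_over_def Lp_loc_2_diff)

lemma Lp_loc_matrix_2_smult:
  "A \<in> matrices_over (Lp_loc 2 UNIV) \<Longrightarrow> (\<lambda>t. map_matrix ((*) z) (A t)) \<in> matrices_over (Lp_loc 2 UNIV)"
  by (simp add: matrices_over_def Lp_loc_2_smult)

lemma Lp_loc_matrix_2_conj_transpose:
  "A \<in> matrices_over (Lp_loc 2 UNIV) \<Longrightarrow> (\<lambda>t. conj_transpose (A t)) \<in> matrices_over (Lp_loc 2 UNIV)"
  by (auto simp: matrices_over_def Lp_loc_2_iff
      intro: measurable_compose[OF _ borel_measurable_continuous_onI[OF continuous_on_cnj[OF continuous_on_id]]])

lemma Lp_loc_matrix_AE:
  "A \<in> matrices_over (Lp_loc p UNIV) \<Longrightarrow> AE t in lebesgue. A t = B t \<Longrightarrow> B \<in> matrices_over (Lp_loc p UNIV)"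
  by (erule (1) matrices_over_AE) (rule Lp_loc_AE)

text \<open>A diagonal entry of the product with the adjoint is the squared norm of a row, and so
  dominates the square of each entry in that row.\<close>

lemma Lp_loc_2_if_mult_conj_transpose:
  fixes T :: "real \<Rightarrow> complex^'q^'p"
  assumes T: "T \<in> matrices_over (meas_on UNIV)" and G: "G \<in> matrices_over (Lp_loc 1 UNIV)"
    and le: "AE t in lebesgue. \<forall>i. Re ((T t ** conj_transpose (T t)) $ i $ i) \<le> Re (G t $ i $ i)"
  shows "T \<in> matrices_over (Lp_loc 2 UNIV)"
  unfolding matrices_over_def
proof (intro CollectI allI)
  fix i j
  show "(\<lambda>t. T t $ i $ j) \<in> Lp_loc 2 UNIV"
  proof (rule Lp_loc_2_dominated)
    show "(\<lambda>t. T t $ i $ j) \<in> borel_measurable lebesgue"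
      using T by (simp add: matrices_over_meas_UNIV)
    show "(\<lambda>t. G t $ i $ i) \<in> Lp_loc 1 UNIV"
      using G by (simp add: matrices_over_def)
    show "AE t in lebesgue. (norm (T t $ i $ j))^2 \<le> norm (G t $ i $ i)"
      using le
    proof eventually_elim
      case (elim t)
      have "(norm (T t $ i $ j))^2 \<le> (\<Sum>j\<in>UNIV. (norm (T t $ i $ j))^2)"
        by (rule member_le_sum) auto
      also have "\<dots> \<le> Re (G t $ i $ i)"
        using elim by (simp add: mult_conj_transpose_diag)
      also have "\<dots> \<le> norm (G t $ i $ i)"
        by (rule complex_Re_le_cmod)
      finally show ?case .
    qed
  qed
qed

section \<open>Periodic functions\<close>

lemma periodic_int:
  fixes f :: "real \<Rightarrow> 'a"
  assumes "\<And>t. f (t + d) = f t"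
  shows "f (t + of_int k * d) = f t"
proof (induction k arbitrary: t rule: int_induct[where k = 0])
  case base
  show ?case by simp
next
  case (step1 i)
  then show ?case using assms[of "t + of_int i * d"] by (simp add: algebra_simps)
next
  case (step2 i)
  then show ?case using assms[of "t + of_int (i - 1) * d"] by (simp add: algebra_simps)
qed

text \<open>Slope 1 in the affine change of variables identifies the measure with its image under
  translation.\<close>

lemma AE_lebesgue_translate:
  fixes c :: real
  assumes "AE t in lebesgue. P t"
  shows "AE t in lebesgue. P (c + t)"
proof -
  have "lebesgue = distr lebesgue lebesgue (\<lambda>t. c + t)"
    using lebesgue_real_affine[of 1 c] by (simp add: density_1)
  then have "AE t in distr lebesgue lebesgue (\<lambda>t. c + t). P t"
    using assms by (rule subst[of lebesgue])
  moreover have "(\<lambda>t. c + t) \<in> lebesgue \<rightarrow>\<^sub>M lebesgue"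
    using lebesgue_affine_measurable[of "\<lambda>_. 1" c] by simp
  ultimately show ?thesis
    by (rule AE_distrD[rotated])
qed

text \<open>The translates of the open period interval cover the line up to the countable set of
  multiples of d, and countably many exceptional null sets may be united.\<close>

lemma AE_periodic:
  fixes d :: real
  assumes d: "0 < d" and per: "\<And>t. P (t + d) = P t" and ae: "AE t in lebesgue_on {0<..<d}. P t"
  shows "AE t in lebesgue. P t"
proof -
  have "{0<..<d} \<in> sets lebesgue"
    by (intro sets_completionI_sets) simp
  then have "AE t in lebesgue. t \<in> {0<..<d} \<longrightarrow> P t"
    using ae by (subst (asm) AE_restrict_space_iff) auto
  then have "AE t in lebesgue. of_int k * d + t \<in> {0<..<d} \<longrightarrow> P (of_int k * d + t)" for k :: int
    by (rule AE_lebesgue_translate)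
  then have 1: "AE t in lebesgue. \<forall>k::int. of_int k * d + t \<in> {0<..<d} \<longrightarrow> P t"
    using periodic_int[of P d, OF per] by (simp only: AE_all_countable add.commute) simp
  have "range (\<lambda>k::int. of_int k * d) \<in> null_sets lborel"
    by (intro countable_imp_null_set_lborel) simp
  then have 2: "AE t in lebesgue. t \<notin> range (\<lambda>k::int. of_int k * d)"
    by (intro AE_completion AE_not_in)
  show ?thesis
    using 1 2
  proof eventually_elim
    case (elim t)
    \<comment> \<open>Shifting by - k d moves t into the half-open period; its left end is excluded
      because t is not a multiple of d.\<close>
    define k where "k = \<lfloor>t / d\<rfloor>"
    have "of_int k * d \<le> t" "t < (of_int k + 1) * d"
      using d by (auto simp: k_def pos_le_divide_eq[symmetric] pos_divide_less_eq[symmetric])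
    moreover have "t \<noteq> of_int k * d"
      using elim(2) by auto
    ultimately have "of_int (- k) * d + t \<in> {0<..<d}"
      by (auto simp: algebra_simps)
    then show ?case
      using elim(1) by blast
  qed
qed

text \<open>On a compact interval |f| is dominated by a finite sum of translates of its restriction
  to one period. Overlaps at multiples of d are harmless for an upper bound.\<close>

lemma Lp_loc_1_periodic:
  fixes d :: real
  assumes d: "0 < d" and per: "\<And>t. f (t + d) = f t"
    and f: "f \<in> borel_measurable lebesgue" and int: "f \<in> Lp 1 {0..d}"
  shows "f \<in> Lp_loc 1 UNIV"
  unfolding Lp_loc_1_iff
proof (intro conjI allI f)
  fix a b :: real
  define g where "g t = indicator {0..d} t *\<^sub>R f t" for t
  have "integrable lebesgue g"
    using int unfolding Lp_1_iff g_def by (subst (asm) integrable_restrict_space) auto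
  then have "integrable lebesgue (\<lambda>t. norm (g (of_int k * d + 1 * t)))" for k :: int
    by (intro integrable_norm lebesgue_integrable_real_affine) auto
  then have sum: "integrable lebesgue (\<lambda>t. \<Sum>k\<in>K. norm (g (of_int k * d + t)))" for K :: "int set"
    by (intro Bochner_Integration.integrable_sum) simp
  \<comment> \<open>For a <= t <= b, the condition 0 <= k d + t <= d forces - b / d <= k <= (d - a)
    / d.\<close>
  define K where "K = {\<lfloor>- b / d\<rfloor> .. \<lceil>(d - a) / d\<rceil>}"
  have "integrable lebesgue (\<lambda>t. indicator {a..b} t *\<^sub>R f t)"
  proof (rule Bochner_Integration.integrable_bound[OF sum[of K]])
    show "(\<lambda>t. indicator {a..b} t *\<^sub>R f t) \<in> borel_measurable lebesgue"
      by (intro borel_measurable_scaleR borel_measurable_indicator f) simp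
    show "AE t in lebesgue. norm (indicator {a..b} t *\<^sub>R f t) \<le> norm (\<Sum>k\<in>K. norm (g (of_int k * d + t)))"
    proof (intro AE_I2)
      fix t :: real
      show "norm (indicator {a..b} t *\<^sub>R f t) \<le> norm (\<Sum>k\<in>K. norm (g (of_int k * d + t)))"
      proof (cases "t \<in> {a..b}")
        case True
        define k where "k = - \<lfloor>t / d\<rfloor>"
        have "of_int \<lfloor>t / d\<rfloor> * d \<le> t" "t < (of_int \<lfloor>t / d\<rfloor> + 1) * d"
          using d by (auto simp: pos_le_divide_eq[symmetric] pos_divide_less_eq[symmetric])
        then have k: "0 \<le> of_int k * d + t" "of_int k * d + t \<le> d"
          by (auto simp: k_def algebra_simps)
        have "- b / d \<le> of_int k" "of_int k \<le> (d - a) / d"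
          using True k d by (auto simp: field_simps)
        then have "k \<in> K"
          by (auto simp: K_def) linarith+
        have "norm (f t) = norm (g (of_int k * d + t))"
          using k periodic_int[of f d t k, OF per] by (simp add: g_def add.commute)
        also have "\<dots> \<le> (\<Sum>k\<in>K. norm (g (of_int k * d + t)))"
          using \<open>k \<in> K\<close> by (intro member_le_sum) (auto simp: K_def)
        also have "\<dots> \<le> norm (\<Sum>k\<in>K. norm (g (of_int k * d + t)))"
          by simp
        finally show ?thesis using True by simp
      qed simp
    qed
  qed
  then show "integrable (lebesgue_on {a..b}) f"
    by (subst integrable_restrict_space) auto
qed

section \<open>The index-1 hypotheses\<close>

text \<open>Once T and U are square integrable and R is bounded, each integrability clause follows
  from an almost everywhere identity and the rules for sums and products.\<close>

lemma local_index_1_pencil: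
  fixes V :: "complex^('p::finite + 'q::finite)^'n"
    and H W :: "real \<Rightarrow> complex^'n^'n"
  assumes V: "unitary_matrix V"
    and H: "H \<in> matrices_over (meas_on UNIV)" and W: "W \<in> matrices_over (meas_on UNIV)"
    and hH: "AE t in lebesgue. conj_transpose (H t) = H t" and pW: "AE t in lebesgue. posdef (W t)"
    and H11: "(\<lambda>t. block11 V (H t)) \<in> matrices_over (Lp_loc 1 UNIV)"
    and W11: "(\<lambda>t. block11 V (W t)) \<in> matrices_over (Lp_loc 1 UNIV)"
    and HWH: "(\<lambda>t. block12 V (H t) ** matrix_inv (block22 V (W t)) ** block21 V (H t))
      \<in> matrices_over (Lp_loc 1 UNIV)"
    and z: "Im z \<noteq> 0"
  shows "local_index_1 V (\<lambda>t. H t - map_matrix ((*) z) (W t)) W UNIV"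
proof -
  define A where "A t = H t - map_matrix ((*) z) (W t)" for t
  define S where "S t = psd_sqrt (block22 V (W t))" for t
  define T where "T t = scaled12 V (W t) (H t)" for t
  define U where "U t = scaled12 V (W t) (W t)" for t
  define B where "B t = T t - map_matrix ((*) z) (U t)" for t
  define B' where "B' t = conj_transpose (T t) - map_matrix ((*) z) (conj_transpose (U t))" for t
  define R where "R t = S t ** matrix_inv (block22 V (A t)) ** S t" for t
  have p22: "AE t in lebesgue. posdef (block22 V (W t))"
    using pW by eventually_elim (rule posdef_block22[OF V])
  have mS: "S \<in> matrices_over (meas_on UNIV)"
    unfolding S_def by (intro meas_psd_sqrt meas_blocks W p22)
  have mA: "A \<in> matrices_over (meas_on UNIV)"
    unfolding A_def by (intro meas_matrix_diff meas_matrix_smult H W)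
  have mInv: "(\<lambda>t. matrix_inv (block22 V (A t))) \<in> matrices_over (meas_on UNIV)"
    by (intro meas_matrix_inv meas_blocks mA)
  have mT: "T \<in> matrices_over (meas_on UNIV)" and mU: "U \<in> matrices_over (meas_on UNIV)"
    unfolding T_def U_def scaled12_def S_def[symmetric]
    by (intro meas_matrix_mult meas_matrix_inv meas_blocks H W mS)+
  have mR: "R \<in> matrices_over (meas_on UNIV)"
    unfolding R_def by (intro meas_matrix_mult mS mInv)
  have T: "T \<in> matrices_over (Lp_loc 2 UNIV)"
  proof (rule Lp_loc_2_if_mult_conj_transpose[OF mT HWH])
    show "AE t in lebesgue. \<forall>i. Re ((T t ** conj_transpose (T t)) $ i $ i) \<le>
        Re ((block12 V (H t) ** matrix_inv (block22 V (W t)) ** block21 V (H t)) $ i $ i)"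
      using hH pW by eventually_elim (simp add: T_def scaled12_mult_conj_transpose[OF V])
  qed
  have U: "U \<in> matrices_over (Lp_loc 2 UNIV)"
  proof (rule Lp_loc_2_if_mult_conj_transpose[OF mU W11])
    show "AE t in lebesgue. \<forall>i. Re ((U t ** conj_transpose (U t)) $ i $ i) \<le> Re (block11 V (W t) $ i $ i)"
      using pW by eventually_elim (simp add: U_def scaled12_self_bound[OF V])
  qed
  have B: "B \<in> matrices_over (Lp_loc 2 UNIV)"
    unfolding B_def by (intro Lp_loc_matrix_2_diff Lp_loc_matrix_2_smult T U)
  have B': "B' \<in> matrices_over (Lp_loc 2 UNIV)"
    unfolding B'_def by (intro Lp_loc_matrix_2_diff Lp_loc_matrix_2_smult Lp_loc_matrix_2_conj_transpose T U)
  have good: "AE t in lebesgue. posdef (W t) \<and> conj_transpose (H t) = H t"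
    using pW hH by eventually_elim simp
  \<comment> \<open>Folding takes two stages because B, B' and R are defined through the names
    folded first.\<close>
  note ids = index_1_identities[OF V _ _ z, where W = "W t" and H = "H t" for t,
      folded A_def S_def T_def U_def, folded B_def B'_def R_def]
  have R: "R \<in> matrices_over (Lp_loc \<infinity> UNIV)"
    unfolding matrices_over_def
  proof (intro CollectI allI, rule Lp_loc_inftyI)
    fix i j
    show "(\<lambda>t. R t $ i $ j) \<in> borel_measurable lebesgue"
      using mR by (simp add: matrices_over_meas_UNIV)
    show "AE t in lebesgue. norm (R t $ i $ j) \<le> 1 / \<bar>Im z\<bar>"
      using good
    proof eventually_elim
      case (elim t)
      show ?case
        by (rule norm_nth_le_of_bound) (use elim ids(2) in blast)
    qed
  qed
  have "local_index_1 V A W UNIV"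
    unfolding local_index_1_def S_def[symmetric] R_def[symmetric]
  proof (intro conjI)
    have "AE t in lebesgue. invertible (block22 V (A t))"
      using good by eventually_elim (simp add: ids(1))
    then show "AE t in lebesgue_on UNIV. invertible (block22 V (A t))"
      unfolding lebesgue_on_UNIV_eq .
    show "(\<lambda>t. matrix_inv (block22 V (A t))) \<in> matrices_over (meas_on UNIV)"
      by (rule mInv)
    show "(\<lambda>t. block12 V (A t) ** matrix_inv (block22 V (A t)) ** S t) \<in> matrices_over (Lp_loc 2 UNIV)"
    proof (rule Lp_loc_matrix_AE[OF Lp_loc_matrix_2_times_infty[OF B R]])
      show "AE t in lebesgue. B t ** R t = block12 V (A t) ** matrix_inv (block22 V (A t)) ** S t"
        using good by eventually_elim (simp add: ids(3))
    qed
    \<comment> \<open>In the product (B R) B', the bracket stays square integrable as R is bounded,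
      and the second product lands in L^1.\<close>
    have "(\<lambda>t. block11 V (H t) - map_matrix ((*) z) (block11 V (W t)) - B t ** R t ** B' t)
        \<in> matrices_over (Lp_loc 1 UNIV)"
      by (intro Lp_loc_matrix_1_diff Lp_loc_matrix_1_smult H11 W11 Lp_loc_matrix_2_times_2
          Lp_loc_matrix_2_times_infty B R B')
    then show "(\<lambda>t. schur_complement V (A t)) \<in> matrices_over (Lp_loc 1 UNIV)"
    proof (rule Lp_loc_matrix_AE)
      show "AE t in lebesgue. block11 V (H t) - map_matrix ((*) z) (block11 V (W t)) - B t ** R t ** B' t =
          schur_complement V (A t)"
        using good by eventually_elim (simp add: ids(4))
    qed
    show "(\<lambda>t. block11 V (W t)) \<in> matrices_over (Lp_loc 1 UNIV)"
      by (rule W11)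
    show "R \<in> matrices_over (Lp_loc \<infinity> UNIV)"
      by (rule R)
    have "(\<lambda>t. conj_transpose (U t) - R t ** B' t) \<in> matrices_over (Lp_loc 2 UNIV)"
      by (intro Lp_loc_matrix_2_diff Lp_loc_matrix_2_conj_transpose Lp_loc_matrix_infty_times_2 U R B')
    then show "(\<lambda>t. S t ** (matrix_inv (block22 V (W t)) ** block21 V (W t) -
        matrix_inv (block22 V (A t)) ** block21 V (A t))) \<in> matrices_over (Lp_loc 2 UNIV)"
    proof (rule Lp_loc_matrix_AE)
      show "AE t in lebesgue. conj_transpose (U t) - R t ** B' t =
          S t ** (matrix_inv (block22 V (W t)) ** block21 V (W t) -
            matrix_inv (block22 V (A t)) ** block21 V (A t))"
        using good by eventually_elim (simp add: ids(5))
    qed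
    have "(\<lambda>t. block11 V (W t) - U t ** conj_transpose (U t)) \<in> matrices_over (Lp_loc 1 UNIV)"
      by (intro Lp_loc_matrix_1_diff Lp_loc_matrix_2_times_2 Lp_loc_matrix_2_conj_transpose W11 U)
    then show "(\<lambda>t. schur_complement V (W t)) \<in> matrices_over (Lp_loc 1 UNIV)"
    proof (rule Lp_loc_matrix_AE)
      show "AE t in lebesgue. block11 V (W t) - U t ** conj_transpose (U t) = schur_complement V (W t)"
        using pW hH by eventually_elim (simp add: ids(6))
    qed
  qed
  then show ?thesis
    by (simp add: A_def[abs_def])
qed

lemma Lp_loc_matrix_1_periodic:
  fixes d :: real
  assumes "0 < d" "\<And>t. A (t + d) = A t" "A \<in> matrices_over (meas_on UNIV)"
    and "A \<in> matrices_over (Lp 1 {0..d})"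
  shows "A \<in> matrices_over (Lp_loc 1 UNIV)"
  using assms unfolding matrices_over_def meas_on_UNIV by (auto intro: Lp_loc_1_periodic)

theorem theorem5p13:
  fixes d :: real
    and J :: "complex^'n^'n"
    and H W :: "real \<Rightarrow> complex^'n^'n"
    and V :: "complex^('p::finite + 'q::finite)^'n"
  assumes "0 < d"
    and "J \<noteq> 0" and "conj_transpose J = - J"
    and "H \<in> matrices_over (meas_on UNIV)" and "W \<in> matrices_over (meas_on UNIV)"
    and "\<And>t. H (t + d) = H t" and "\<And>t. W (t + d) = W t"
    and "AE t in lebesgue. conj_transpose (W t) = W t \<and> psd (W t) \<and> det (W t) \<noteq> 0"
    and "AE t in lebesgue_on {0<..<d}. conj_transpose (H t) = H t"
    and "det J = 0"
    and "CARD('p) = rank J" and "CARD('q) = vec.dim {x. J *v x = 0}"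
    and "kernel_splitting J V"
  shows
    "((\<lambda>t. block11 V (H t)) \<in> matrices_over (Lp_loc 1 UNIV) \<and>
      (\<lambda>t. block11 V (W t)) \<in> matrices_over (Lp_loc 1 UNIV) \<and>
      (\<lambda>t. block12 V (H t) ** matrix_inv (block22 V (W t)) ** block21 V (H t))
        \<in> matrices_over (Lp_loc 1 UNIV)
      \<longrightarrow> (\<forall>z\<^sub>0. z\<^sub>0 \<notin> \<real> \<longrightarrow>
            local_index_1 V (\<lambda>t. H t - map_matrix ((*) z\<^sub>0) (W t)) W UNIV)) \<and>
     ((\<lambda>t. block11 V (H t)) \<in> matrices_over (Lp 1 {0..d}) \<and>
      (\<lambda>t. block11 V (W t)) \<in> matrices_over (Lp 1 {0..d}) \<and>
      (\<lambda>t. block12 V (H t) ** matrix_inv (block22 V (W t)) ** block21 V (H t))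
        \<in> matrices_over (Lp 1 {0..d})
      \<longrightarrow> (\<forall>z\<^sub>0. z\<^sub>0 \<notin> \<real> \<longrightarrow>
            local_index_1 V (\<lambda>t. H t - map_matrix ((*) z\<^sub>0) (W t)) W UNIV))"
proof -
  have V: "unitary_matrix V"
    using assms(13) by (simp add: kernel_splitting_def)
  have pW: "AE t in lebesgue. posdef (W t)"
    using assms(8) by eventually_elim (simp add: posdef_if_psd_det)
  have hH: "AE t in lebesgue. conj_transpose (H t) = H t"
    by (rule AE_periodic[OF assms(1) _ assms(9)]) (simp add: assms(6))
  have main: "local_index_1 V (\<lambda>t. H t - map_matrix ((*) z) (W t)) W UNIV"
    if "(\<lambda>t. block11 V (H t)) \<in> matrices_over (Lp_loc 1 UNIV)"
      "(\<lambda>t. block11 V (W t)) \<in> matrices_over (Lp_loc 1 UNIV)"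
      "(\<lambda>t. block12 V (H t) ** matrix_inv (block22 V (W t)) ** block21 V (H t))
        \<in> matrices_over (Lp_loc 1 UNIV)" "z \<notin> \<real>" for z
    using that by (intro local_index_1_pencil[OF V assms(4,5) hH pW]) (auto simp: complex_is_Real_iff)
  \<comment> \<open>All three matrix functions in the hypothesis have the form F (H t) (W t) and so
    inherit the period d.\<close>
  have periodic: "(\<lambda>t. F (H t) (W t)) \<in> matrices_over (Lp_loc 1 UNIV)"
    if "(\<lambda>t. F (H t) (W t)) \<in> matrices_over (Lp 1 {0..d})"
      "(\<lambda>t. F (H t) (W t)) \<in> matrices_over (meas_on UNIV)" for F :: "_ \<Rightarrow> _ \<Rightarrow> complex^'p^'p"
    by (rule Lp_loc_matrix_1_periodic[OF assms(1) _ that(2,1)]) (simp add: assms(6,7))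
  \<comment> \<open>Membership in L^1 over one period gives measurability there only; on the whole
    line it comes from H and W.\<close>
  have meas: "(\<lambda>t. block11 V (H t)) \<in> matrices_over (meas_on UNIV)"
    "(\<lambda>t. block11 V (W t)) \<in> matrices_over (meas_on UNIV)"
    "(\<lambda>t. block12 V (H t) ** matrix_inv (block22 V (W t)) ** block21 V (H t)) \<in> matrices_over (meas_on UNIV)"
    by (intro meas_matrix_mult meas_matrix_inv meas_blocks assms(4,5))+
  show ?thesis
    using main periodic[of "\<lambda>h w. block11 V h", OF _ meas(1)] periodic[of "\<lambda>h w. block11 V w", OF _ meas(2)]
      periodic[of "\<lambda>h w. block12 V h ** matrix_inv (block22 V w) ** block21 V h", OF _ meas(3)]
    by blast
qed

end
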